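(* Let $X$ be a complete, locally convex median space and let $\mathcal{M}(X)$ be the median space of admissible ultrafilters associated to the measured wall structure on $X$ given by its convex walls. Then the isometric embedding $X\hookrightarrow\mathcal{M}(X)$, $x\mapsto\sigma_x$, is a surjective isometry.
   Context: A metric space $(X,d)$ is a median space if for all $x,y,z\in X$ there is a unique point $m=m(x,y,z)$ lying in $I(x,y)\cap I(y,z)\cap I(z,x)$, where $I(x,y)=\{z\in X\mid d(x,y)=d(x,z)+d(z,y)\}$. A subset $C\subseteq X$ is convex if $I(x,y)\subseteq C$ for all $x,y\in C$. $X$ is locally convex if every point has a basis of convex neighbourhoods. A (convex) halfspace is a nonempty convex subset $\mathfrak{h}\subseteq X$ whose complement $\mathfrak{h}^*=X\setminus\mathfrak{h}$ is also nonempty and convex; $\mathcal{H}$ is the set of halfspaces. A (convex) wall is an unordered pair $\{\mathfrak{h},\mathfrak{h}^*\}$; $\mathcal{W}$ is the set of walls and $\pi\colon\mathcal{H}\to\mathcal{W}$, $\mathfrak{h}\mapsto\{\mathfrak{h},\mathfrak{h}^*\}$. For $x,y\in X$, $\mathcal{W}(x|y)$ is the set of walls having $x$ and $y$ on different sides (a wall-interval). An ultrafilter on $\mathcal{H}$ is a subset $\sigma\subseteq\mathcal{H}$ such that any two elements of $\sigma$ intersect and, for every $\mathfrak{h}\in\mathcal{H}$, $\mathfrak{h}\in\sigma$ or $\mathfrak{h}^*\in\sigma$. For $x\in X$, $\sigma_x=\{\mathfrak{h}\in\mathcal{H}\mid x\in\mathfrak{h}\}$ is an ultrafilter. Let $\mathcal{B}$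 be the $\sigma$-algebra on $\mathcal{W}$ generated by wall-intervals and let $\mu$ be the measure on $\mathcal{B}$ with $\mu(\mathcal{W}(x|y))=d(x,y)$ for all $x,y$, obtained by Carath\'eodory's extension from the ring of finite disjoint unions of wall-intervals (known to exist by work of Chatterji--Dru\c{t}u--Haglund); thus $\mu(E)=\inf\sum_n d(x_n,y_n)$ over countable covers of $E$ by wall-intervals $\mathcal{W}(x_n|y_n)$, with $\mu(E)=+\infty$ if there is no such cover. Put $\pi^*\mathcal{B}=\{\pi^{-1}(E)\mid E\in\mathcal{B}\}$ and $\pi^*\mu(\pi^{-1}(E))=\mu(E)$. Fix $x\in X$. An ultrafilter $\sigma\subseteq\mathcal{H}$ is admissible if $\sigma\triangle\sigma_x\in\pi^*\mathcal{B}$ and $\pi^*\mu(\sigma\triangle\sigma_x)<+\infty$ (this does not depend on $x$). $\mathcal{M}(X)$ is the set of admissible ultrafilters with the pseudo-metric $d(\sigma_1,\sigma_2)=\pi^*\mu(\sigma_1\triangle\sigma_2)$, where ultrafilters at distance zero are identified; it is a median space. *)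

theory Defs
  imports "HOL-Analysis.Analysis"
begin

text \<open>The median space is the whole universe of a type of class \<^class>\<open>metric_space\<close>.\<close>

definition metric_interval :: "'a::metric_space \<Rightarrow> 'a \<Rightarrow> 'a set" where
  "metric_interval x y = {z. dist x y = dist x z + dist z y}"

definition median_space :: "'a::metric_space itself \<Rightarrow> bool" where
  "median_space _ \<longleftrightarrow>
     (\<forall>x y z :: 'a. \<exists>!m. m \<in> metric_interval x y \<inter> metric_interval y z \<inter> metric_interval z x)"

definition median_convex :: "'a::metric_space set \<Rightarrow> bool" where
  "median_convex C \<longleftrightarrow> (\<forall>x\<in>C. \<forall>y\<in>C. metric_interval x y \<subseteq> C)"

text \<open>The basis consists of convex neighbourhoods, which need not be open.\<close>

definition locally_median_convex :: "'a::metric_space itself \<Rightarrow> bool" where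
  "locally_median_convex _ \<longleftrightarrow>
     (\<forall>x :: 'a. \<forall>U. open U \<and> x \<in> U \<longrightarrow> (\<exists>C. median_convex C \<and> x \<in> interior C \<and> C \<subseteq> U))"

definition halfspaces :: "'a::metric_space set set" where
  "halfspaces = {h. h \<noteq> {} \<and> - h \<noteq> {} \<and> median_convex h \<and> median_convex (- h)}"

definition wall_of :: "'a set \<Rightarrow> 'a set set" where
  "wall_of h = {h, - h}"

definition walls :: "'a::metric_space set set set" where
  "walls = wall_of ` halfspaces"

definition wall_interval :: "'a::metric_space \<Rightarrow> 'a \<Rightarrow> 'a set set set" where
  "wall_interval x y = {w \<in> walls. \<exists>h\<in>w. x \<in> h \<and> y \<notin> h}"

text \<open>
  The outer measure induced by \<open>wall_interval x y \<mapsto> dist x y\<close>. Finite covers are included, as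
  \<open>wall_interval x x\<close> is empty; if \<open>E\<close> has no countable cover, the infimum of the empty set
  is \<open>\<infinity>\<close>.
\<close>

definition wall_outer_measure :: "'a::metric_space set set set \<Rightarrow> ennreal" where
  "wall_outer_measure E =
     (INF (p, q) \<in> {(p, q). E \<subseteq> (\<Union>n::nat. wall_interval (p n) (q n))}.
        \<Sum>n. ennreal (dist (p n) (q n)))"

text \<open>
  The restriction of the outer measure to the sigma-algebra generated by the wall-intervals.
  In a median space this restriction is a measure, by Caratheodory's extension theorem, so
  the degenerate case of \<^const>\<open>measure_of\<close> does not occur.
\<close>

definition wall_measure :: "'a::metric_space set set measure" where
  "wall_measure =
     measure_of walls {wall_interval x y | x y. True} wall_outer_measure"

definition halfspace_algebra :: "'a::metric_space set set set" where
  "halfspace_algebra = {wall_of -` E \<inter> halfspaces | E. E \<in> sets wall_measure}"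

text \<open>
  As \<^const>\<open>wall_of\<close> maps the halfspaces onto the walls, the image of the preimage of a set of
  walls is that set; this makes the pulled-back measure a direct definition.
\<close>

definition halfspace_measure :: "'a::metric_space set set \<Rightarrow> ennreal" where
  "halfspace_measure H = emeasure wall_measure (wall_of ` H)"

lemma halfspace_measure_vimage:
  assumes "E \<in> sets wall_measure"
  shows "halfspace_measure (wall_of -` E \<inter> halfspaces) = emeasure wall_measure E"
proof -
  have "space wall_measure = (walls :: 'a set set set)"
    unfolding wall_measure_def
    by (rule space_measure_of) (auto simp: wall_interval_def)
  then have "E \<subseteq> walls"
    using sets.sets_into_space[OF assms] by simp
  then have "wall_of ` (wall_of -` E \<inter> halfspaces) = E"
    by (auto simp: walls_def)
  then show ?thesis
    by (simp add: halfspace_measure_def)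
qed

definition halfspace_ultrafilter :: "'a::metric_space set set \<Rightarrow> bool" where
  "halfspace_ultrafilter \<sigma> \<longleftrightarrow>
     \<sigma> \<subseteq> halfspaces \<and> (\<forall>h\<in>\<sigma>. \<forall>k\<in>\<sigma>. h \<inter> k \<noteq> {}) \<and> (\<forall>h\<in>halfspaces. h \<in> \<sigma> \<or> - h \<in> \<sigma>)"

definition point_ultrafilter :: "'a::metric_space \<Rightarrow> 'a set set" where
  "point_ultrafilter x = {h \<in> halfspaces. x \<in> h}"

text \<open>The first argument is the base point in the definition of admissibility.\<close>

definition admissible :: "'a::metric_space \<Rightarrow> 'a set set \<Rightarrow> bool" where
  "admissible x \<sigma> \<longleftrightarrow>
     halfspace_ultrafilter \<sigma> \<and>
     sym_diff \<sigma> (point_ultrafilter x) \<in> halfspace_algebra \<and>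
     halfspace_measure (sym_diff \<sigma> (point_ultrafilter x)) < \<infinity>"

definition ultrafilter_dist :: "'a::metric_space set set \<Rightarrow> 'a set set \<Rightarrow> real" where
  "ultrafilter_dist \<sigma> \<tau> = enn2real (halfspace_measure (sym_diff \<sigma> \<tau>))"

definition dist_zero_rel :: "'a::metric_space \<Rightarrow> ('a set set \<times> 'a set set) set" where
  "dist_zero_rel x = {(\<sigma>, \<tau>). admissible x \<sigma> \<and> admissible x \<tau> \<and> ultrafilter_dist \<sigma> \<tau> = 0}"

definition admissible_space :: "'a::metric_space \<Rightarrow> 'a set set set set" where
  "admissible_space x = {\<sigma>. admissible x \<sigma>} // dist_zero_rel x"

text \<open>
  The distance between two classes is the common value of \<^const>\<open>ultrafilter_dist\<close> on all pairs
  of representatives.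
\<close>

definition admissible_space_dist ::
    "'a::metric_space set set set \<Rightarrow> 'a set set set \<Rightarrow> real" where
  "admissible_space_dist S T = the_elem (\<Union>\<sigma>\<in>S. \<Union>\<tau>\<in>T. {ultrafilter_dist \<sigma> \<tau>})"

definition ultrafilter_embedding :: "'a::metric_space \<Rightarrow> 'a \<Rightarrow> 'a set set set" where
  "ultrafilter_embedding x y = dist_zero_rel x `` {point_ultrafilter y}"

end

theory Submission
  imports Defs
begin

text \<open>
  The halfspaces \<open>h\<close> with \<open>p \<notin> h\<close> and \<open>q \<in> h\<close> form a closed subset of the Cantor cube of all
  subsets, in which every wall-interval is clopen. Hence a countable cover of a wall-interval by
  wall-intervals has a finite subcover, and its total length is at least the distance, because
  projections to intervals are 1-Lipschitz and preserve betweenness; so the outer measure of a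
  wall-interval is the distance of its endpoints.

  For an admissible ultrafilter \<open>\<sigma>\<close> the walls between \<open>p\<close> and \<open>q\<close> are, up to a set of small measure,
  the union of two compact sets, one of halfspaces in \<open>\<sigma>\<close> and one of halfspaces outside \<open>\<sigma>\<close>. Any
  \<open>h\<close> of the first and \<open>k\<close> of the second have a point in \<open>h - k\<close>, so by compactness finitely many
  joins and meets in the interval give one point separating the two families: it agrees with \<open>\<sigma>\<close> on
  almost all of these walls. Moving a base point successively towards such points, for finitely many
  intervals that carry almost all walls between \<open>\<sigma>\<close> and the base point, gives points arbitrarily
  close to \<open>\<sigma>\<close>, and completeness finishes the proof.
\<close>

subsection \<open>Medians and halfspaces\<close>

definition med :: "'a::metric_space \<Rightarrow> 'a \<Rightarrow> 'a \<Rightarrow> 'a" where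
  "med x y z = (THE m. m \<in> metric_interval x y \<inter> metric_interval y z \<inter> metric_interval z x)"

lemma in_interval_iff: "z \<in> metric_interval x y \<longleftrightarrow> dist x y = dist x z + dist z y"
  by (simp add: metric_interval_def)

lemma interval_commute: "metric_interval x y = metric_interval y x"
  by (auto simp: metric_interval_def dist_commute)

lemma endpoints_in_interval [simp]: "x \<in> metric_interval x y" "y \<in> metric_interval x y"
  by (auto simp: metric_interval_def)

text \<open>The two hypotheses give a path through \<open>x\<close>, \<open>w\<close>,
  \<open>z\<close>, \<open>y\<close> of total length \<open>dist x y\<close>, so every triangle
  inequality along it is an equality.\<close>

lemma interval_trans:
  assumes "w \<in> metric_interval x z" "z \<in> metric_interval x y"
  shows "w \<in> metric_interval x y" and "z \<in> metric_interval w y"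
  using assms dist_triangle[of w y z] dist_triangle[of x y w] dist_triangle[of x z w]
  unfolding in_interval_iff by linarith+

lemma interval_antisym:
  assumes "w \<in> metric_interval x z" "z \<in> metric_interval x w"
  shows "w = z"
proof -
  have "dist w z + dist z w = 0"
    using assms unfolding in_interval_iff by linarith
  then show ?thesis
    by (simp add: dist_commute)
qed

lemma dist_le_of_mem_interval:
  assumes "a \<in> metric_interval p q" "b \<in> metric_interval p q"
  shows "dist a b \<le> dist p q"
  using assms dist_triangle[of a b p] dist_triangle[of a b q]
  unfolding in_interval_iff by (simp add: dist_commute)

locale median_metric =
  fixes T :: "'a::metric_space itself"
  assumes median: "median_space TYPE('a)"
begin

lemma med_in_intervals:
  fixes x y z :: 'a
  shows "med x y z \<in> metric_interval x y" "med x y z \<in> metric_interval y z"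
    "med x y z \<in> metric_interval x z"
proof -
  have "med x y z \<in> metric_interval x y \<inter> metric_interval y z \<inter> metric_interval z x"
    unfolding med_def by (rule theI') (use median in \<open>auto simp: median_space_def\<close>)
  then show "med x y z \<in> metric_interval x y" "med x y z \<in> metric_interval y z"
    "med x y z \<in> metric_interval x z"
    by (auto simp: interval_commute)
qed

lemma med_unique:
  fixes x y z m :: 'a
  assumes "m \<in> metric_interval x y" "m \<in> metric_interval y z" "m \<in> metric_interval x z"
  shows "med x y z = m"
proof -
  have "\<exists>!m. m \<in> metric_interval x y \<inter> metric_interval y z \<inter> metric_interval z x"
    using median by (auto simp: median_space_def)
  then show ?thesis
    using assms med_in_intervals[of x y z] interval_commute[of z x] by blast
qed

lemma med_eq_iff: "med x y z = z \<longleftrightarrow> z \<in> metric_interval x (y::'a)"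
  by (metis endpoints_in_interval(2) med_in_intervals(1) med_unique)

text \<open>The medians of \<open>z\<close> with the two halves of \<open>x, w, y\<close> have the same median with \<open>z\<close> as
  \<open>x\<close> and \<open>y\<close>, by uniqueness.\<close>

lemma med_gate:
  fixes x y z w :: 'a
  assumes w: "w \<in> metric_interval x y"
  shows "med x y z \<in> metric_interval z w"
proof -
  define a b where "a = med x w z" and "b = med y w z"
  define u where "u = med a b z"
  have a: "a \<in> metric_interval x w" "a \<in> metric_interval z w" "a \<in> metric_interval z x"
    and b: "b \<in> metric_interval y w" "b \<in> metric_interval z w" "b \<in> metric_interval z y"
    and u: "u \<in> metric_interval a b" "u \<in> metric_interval z a" "u \<in> metric_interval z b"
    using med_in_intervals[of x w z] med_in_intervals[of y w z] med_in_intervals[of a b z]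
    by (auto simp: a_def b_def u_def interval_commute)
  have "u \<in> metric_interval z x" "u \<in> metric_interval z y" "u \<in> metric_interval z w"
    using interval_trans(1)[OF u(2) a(3)] interval_trans(1)[OF u(3) b(3)]
      interval_trans(1)[OF u(2) a(2)] .
  moreover have "u \<in> metric_interval x y"
  proof -
    \<comment> \<open>The path \<open>x\<close>, \<open>a\<close>, \<open>w\<close>,
      \<open>b\<close>, \<open>y\<close> realises the distance. Replacing \<open>w\<close> by
      \<open>u\<close>, which lies between \<open>a\<close> and \<open>b\<close>, cannot lengthen
      it, so \<open>u\<close> lies between \<open>x\<close> and \<open>y\<close>.\<close>
    have "dist x y = dist x a + dist a w + dist w b + dist b y"
      using w a(1) b(1) unfolding in_interval_iff by (simp add: dist_commute)
    then show ?thesis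
      using u(1) dist_triangle[of a b w] dist_triangle[of x y u] dist_triangle[of x u a]
        dist_triangle[of u y b]
      unfolding in_interval_iff by linarith
  qed
  ultimately show ?thesis
    using med_unique[of u x y z] by (simp add: interval_commute)
qed

text \<open>By \<open>med_gate\<close>, each projection lies between its own point and the other
  projection. Adding the two equalities and using the triangle inequality bounds twice the distance
  of the projections by \<open>2 * dist z z'\<close>.\<close>

lemma med_lipschitz: "dist (med x y z) (med x y z') \<le> dist z (z'::'a)"
proof -
  let ?m = "med x y z" and ?n = "med x y z'"
  have "?m \<in> metric_interval z ?n" "?n \<in> metric_interval z' ?m"
    using med_gate med_in_intervals(1) by blast+
  then show ?thesis
    using dist_triangle[of z ?n z'] dist_triangle[of z' ?m z]
    unfolding in_interval_iff by (simp add: dist_commute)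
qed

text \<open>The gate \<open>?g\<close> of \<open>c\<close> lies on the way from \<open>c\<close> to
  \<open>a\<close> and from \<open>c\<close> to \<open>b\<close>, so the path from \<open>a\<close>
  to \<open>b\<close> through \<open>c\<close> contains a detour of length
  \<open>2 * dist c ?g\<close>, which must vanish.\<close>

lemma interval_convex: "median_convex (metric_interval x (y::'a))"
  unfolding median_convex_def
proof (intro ballI subsetI)
  fix a b c assume ab: "a \<in> metric_interval x y" "b \<in> metric_interval x y"
    and c: "c \<in> metric_interval a b"
  let ?g = "med x y c"
  have "?g \<in> metric_interval c a" "?g \<in> metric_interval c b"
    using med_gate ab by blast+
  then have "dist c ?g = 0"
    using c dist_triangle[of a b ?g] zero_le_dist[of c ?g] unfolding in_interval_iff
    by (simp add: dist_commute)
  then show "c \<in> metric_interval x y"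
    using med_in_intervals(1)[of x y c] by simp
qed

text \<open>Seen from \<open>p\<close>, the gate \<open>n\<close> of \<open>v\<close> between
  \<open>x\<close> and \<open>y\<close> is behind \<open>v\<close>, so it is also the gate of
  \<open>p\<close> and lies between \<open>p\<close> and \<open>z\<close>. In other words, the
  shadow that \<open>v\<close> casts from \<open>p\<close> is convex.\<close>

lemma shadow_convex:
  fixes v x y z p :: 'a
  assumes "v \<in> metric_interval p x" "v \<in> metric_interval p y" "z \<in> metric_interval x y"
  shows "v \<in> metric_interval p z"
proof -
  define n where "n = med x y v"
  have n: "n \<in> metric_interval x y" "n \<in> metric_interval v x" "n \<in> metric_interval v y"
    using med_in_intervals[of x y v] by (auto simp: n_def interval_commute)
  have *: "n \<in> metric_interval p t \<and> v \<in> metric_interval p n"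
    if "v \<in> metric_interval p t" "n \<in> metric_interval v t" for t
    using that interval_trans[of n t v p] by (simp add: interval_commute)
  have "med x y p = n"
    using med_unique n(1) *[OF assms(1) n(2)] *[OF assms(2) n(3)] by (simp add: interval_commute)
  then have "n \<in> metric_interval p z"
    using med_gate assms(3) by metis
  then show ?thesis
    using *[OF assms(1) n(2)] interval_trans(1) by blast
qed

text \<open>The median \<open>v\<close> of the three projections equals \<open>?p z\<close>:
  convexity of shadows puts \<open>v\<close> between \<open>?p z\<close> and \<open>z\<close>, while
  the gate property puts \<open>?p z\<close> between \<open>z\<close> and \<open>v\<close>.\<close>

lemma med_preserves_interval:
  fixes a b x y z :: 'a
  assumes "z \<in> metric_interval x y"
  shows "med a b z \<in> metric_interval (med a b x) (med a b y)"
proof -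
  let ?p = "med a b"
  define v where "v = med (?p x) (?p y) (?p z)"
  have v: "v \<in> metric_interval (?p x) (?p y)" "v \<in> metric_interval (?p z) (?p x)"
    "v \<in> metric_interval (?p z) (?p y)"
    using med_in_intervals[of "?p x" "?p y" "?p z"] by (auto simp: v_def interval_commute)
  have *: "v \<in> metric_interval (?p z) t" if "v \<in> metric_interval (?p z) (?p t)" for t
    using that interval_trans(1) med_gate[OF med_in_intervals(1)] interval_commute by metis
  have "v \<in> metric_interval (?p z) z"
    using shadow_convex[OF *[OF v(2)] *[OF v(3)] assms] .
  moreover have "v \<in> metric_interval a b"
    using v(1) interval_convex med_in_intervals(1) unfolding median_convex_def by blast
  then have "?p z \<in> metric_interval z v"
    by (rule med_gate)
  ultimately have "v = ?p z"
    using interval_antisym interval_commute by metis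
  then show ?thesis
    using v(1) by simp
qed

text \<open>Project to the interval from \<open>w\<close> to \<open>p\<close>. Passing from
  \<open>u\<close>, \<open>v\<close> to \<open>c\<close>, \<open>c'\<close> moves the projections
  towards \<open>w\<close>, which stays between them. Hence the gate \<open>e\<close> of
  \<open>w\<close> between \<open>c\<close> and \<open>c'\<close> projects to \<open>w\<close>, that
  is, \<open>w\<close> lies between \<open>e\<close> and \<open>p\<close>.\<close>

lemma join_convex:
  fixes C :: "'a set"
  assumes C: "median_convex C"
  shows "median_convex (\<Union>c\<in>C. metric_interval c p)"
  unfolding median_convex_def
proof (intro ballI subsetI)
  fix u v w
  assume "u \<in> (\<Union>c\<in>C. metric_interval c p)" "v \<in> (\<Union>c\<in>C. metric_interval c p)"
    and w: "w \<in> metric_interval u v"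
  then obtain c c' where c: "c \<in> C" "u \<in> metric_interval c p"
    and c': "c' \<in> C" "v \<in> metric_interval c' p" by blast
  define e where "e = med c c' w"
  have e: "e \<in> metric_interval c c'" "e \<in> metric_interval c w" "e \<in> metric_interval c' w"
    using med_in_intervals[of c c' w] by (auto simp: e_def)
  then have "e \<in> C"
    using c c' C unfolding median_convex_def by blast
  let ?r = "med w p"
  have rw: "?r w = w" and rp: "?r p = p"
    by (auto intro: med_unique)
  have pr: "?r z \<in> metric_interval (?r x) (?r y)" if "z \<in> metric_interval x y" for x y z
    using that by (rule med_preserves_interval)
  have chain: "?r t \<in> metric_interval w (?r s)" if "s \<in> metric_interval t p" for s t
  proof -
    have "?r s \<in> metric_interval (?r t) p" "?r t \<in> metric_interval w p"
      using pr[OF that] rp med_in_intervals(1) by auto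
    then show ?thesis
      using interval_trans(2) interval_commute by metis
  qed
  have "w \<in> metric_interval (?r u) (?r v)"
    using pr[OF w] rw by simp
  then have "w \<in> metric_interval (?r c) (?r v)"
    using chain[OF c(2)] interval_trans(2)[of "?r c" "?r u" w "?r v"] interval_commute by metis
  then have "w \<in> metric_interval (?r c) (?r c')"
    using chain[OF c'(2)] interval_trans(2)[of "?r c'" "?r v" w "?r c"] interval_commute by metis
  then have "med (?r c) (?r c') w = w"
    by (simp add: med_eq_iff)
  moreover have "med (?r c) (?r c') w = ?r e"
    using pr[OF e(1)] pr[OF e(2)] pr[OF e(3)] rw by (intro med_unique) auto
  ultimately have "w \<in> metric_interval e p"
    using med_in_intervals(3)[of w p e] med_in_intervals(2)[of w p e] interval_commute by metis
  then show "w \<in> (\<Union>c\<in>C. metric_interval c p)"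
    using \<open>e \<in> C\<close> by blast
qed

text \<open>The Pasch property. The common point is the median \<open>w\<close> of
  \<open>d0\<close>, \<open>d\<close>, \<open>c1\<close>: projection to the interval from
  \<open>c1\<close> to \<open>w\<close> sends \<open>d0\<close> and \<open>d\<close> to
  \<open>w\<close>, which forces \<open>c\<close> to go to \<open>c1\<close> and then
  \<open>c0\<close> to \<open>w\<close>.\<close>

lemma pasch:
  fixes c c0 c1 d d0 :: 'a
  assumes d: "d \<in> metric_interval c c0" and c1: "c1 \<in> metric_interval c d0"
  shows "metric_interval c0 c1 \<inter> metric_interval d0 d \<noteq> {}"
proof -
  define w where "w = med d0 d c1"
  have w: "w \<in> metric_interval d0 d" "w \<in> metric_interval c1 d" "w \<in> metric_interval c1 d0"
    using med_in_intervals[of d0 d c1] by (auto simp: w_def interval_commute)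
  let ?r = "med c1 w"
  have rd: "?r d = w" and rd0: "?r d0 = w" and rc1: "?r c1 = c1"
    using w by (auto intro!: med_unique)
  have pr: "?r z \<in> metric_interval (?r x) (?r y)" if "z \<in> metric_interval x y" for x y z
    using that by (rule med_preserves_interval)
  have rI: "?r t \<in> metric_interval c1 w" for t
    by (rule med_in_intervals)
  have "c1 \<in> metric_interval (?r c) w"
    using pr[OF c1] rc1 rd0 by simp
  then have rc: "?r c = c1"
    using interval_antisym rI interval_commute by metis
  then have "w \<in> metric_interval c1 (?r c0)"
    using pr[OF d] rd by simp
  then have "?r c0 = w"
    using interval_antisym rI by metis
  then have "w \<in> metric_interval c0 c1"
    using med_in_intervals(3)[of c1 w c0] interval_commute by metis
  then show ?thesis
    using w(1) by blast
qed

section \<open>Separation of disjoint convex sets by halfspaces\<close>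

lemma maximal_convex_disjoint:
  fixes C D :: "'a set"
  assumes "median_convex C" "C \<inter> D = {}"
  obtains M where "C \<subseteq> M" "median_convex M" "M \<inter> D = {}"
    "\<And>N. M \<subseteq> N \<Longrightarrow> median_convex N \<Longrightarrow> N \<inter> D = {} \<Longrightarrow> N = M"
proof -
  define S where "S = {M. C \<subseteq> M \<and> median_convex M \<and> M \<inter> D = {}}"
  have "C \<in> S"
    using assms by (simp add: S_def)
  have "\<Union>\<C> \<in> S" if ne: "\<C> \<noteq> {}" and ch: "subset.chain S \<C>" for \<C>
  proof -
    have sub: "N \<in> S" if "N \<in> \<C>" for N
      using ch that by (auto simp: subset_chain_def)
    have "median_convex (\<Union>\<C>)"
      unfolding median_convex_def
    proof (intro ballI)
      fix x y assume "x \<in> \<Union>\<C>" "y \<in> \<Union>\<C>"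
      then obtain N1 N2 where "N1 \<in> \<C>" "x \<in> N1" "N2 \<in> \<C>" "y \<in> N2"
        by auto
      moreover from this have "N1 \<subseteq> N2 \<or> N2 \<subseteq> N1"
        using ch by (auto simp: subset_chain_def)
      ultimately obtain N where N: "N \<in> \<C>" "x \<in> N" "y \<in> N"
        by (metis subsetD)
      then have "metric_interval x y \<subseteq> N"
        using sub[OF N(1)] by (simp add: S_def median_convex_def)
      then show "metric_interval x y \<subseteq> \<Union>\<C>"
        using N(1) by auto
    qed
    moreover have "C \<subseteq> \<Union>\<C>"
      using ne sub unfolding S_def by auto
    moreover have "\<Union>\<C> \<inter> D = {}"
      using sub unfolding S_def by auto
    ultimately show ?thesis
      by (simp add: S_def)
  qed
  then obtain M where "M \<in> S" and max: "\<And>N. N \<in> S \<Longrightarrow> M \<subseteq> N \<Longrightarrow> N = M"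
    using subset_Zorn_nonempty[of S] \<open>C \<in> S\<close> by (metis empty_iff)
  show thesis
  proof (rule that[of M])
    fix N assume "M \<subseteq> N" "median_convex N" "N \<inter> D = {}"
    moreover from this have "N \<in> S"
      using \<open>M \<in> S\<close> by (auto simp: S_def)
    ultimately show "N = M"
      using max by simp
  qed (use \<open>M \<in> S\<close> in \<open>auto simp: S_def\<close>)
qed

text \<open>Kakutani's argument: enlarge \<open>C\<close> to a maximal \<open>M\<close>, then
  \<open>D\<close> to a maximal \<open>E\<close>. If a point \<open>c\<close> missed both,
  maximality would make the join of \<open>c\<close> with \<open>M\<close> meet \<open>D\<close> and
  its join with \<open>E\<close> meet \<open>M\<close>. The Pasch property then yields a common
  point of \<open>M\<close> and \<open>E\<close>.\<close>

theorem halfspace_separation: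
  fixes C D :: "'a set"
  assumes "median_convex C" "median_convex D" "C \<inter> D = {}" "C \<noteq> {}" "D \<noteq> {}"
  obtains h where "h \<in> halfspaces" "C \<subseteq> h" "h \<inter> D = {}"
proof -
  obtain M where M: "C \<subseteq> M" "median_convex M" "M \<inter> D = {}"
    and Mmax: "\<And>N. M \<subseteq> N \<Longrightarrow> median_convex N \<Longrightarrow> N \<inter> D = {} \<Longrightarrow> N = M"
    using maximal_convex_disjoint[OF assms(1,3)] by blast
  obtain E where E: "D \<subseteq> E" "median_convex E" "E \<inter> M = {}"
    and Emax: "\<And>N. E \<subseteq> N \<Longrightarrow> median_convex N \<Longrightarrow> N \<inter> M = {} \<Longrightarrow> N = E"
    using maximal_convex_disjoint[of D M] assms(2) M by blast
  have "c \<in> M \<union> E" for c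
  proof (rule ccontr)
    assume c: "c \<notin> M \<union> E"
    let ?JM = "\<Union>a\<in>M. metric_interval a c" and ?JE = "\<Union>a\<in>E. metric_interval a c"
    obtain m e where "m \<in> M" "e \<in> E"
      using M(1) E(1) assms(4,5) by blast
    then have "M \<subseteq> ?JM" "c \<in> ?JM" "E \<subseteq> ?JE" "c \<in> ?JE"
      using endpoints_in_interval by blast+
    then have "?JM \<inter> D \<noteq> {}" and "?JE \<inter> M \<noteq> {}"
      using Mmax[OF _ join_convex[OF M(2)]] Emax[OF _ join_convex[OF E(2)]] c by (metis UnCI)+
    then obtain c0 d d0 c1 where c: "c0 \<in> M" "c1 \<in> M" "d \<in> D" "d0 \<in> E"
      and "d \<in> metric_interval c0 c" "c1 \<in> metric_interval d0 c"
      by auto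
    then have "metric_interval c0 c1 \<inter> metric_interval d0 d \<noteq> {}"
      using pasch interval_commute by metis
    moreover have "metric_interval c0 c1 \<subseteq> M"
      using M(2) c(1,2) by (simp add: median_convex_def)
    moreover have "d \<in> E"
      using E(1) c(3) by (rule subsetD)
    then have "metric_interval d0 d \<subseteq> E"
      using E(2) c(4) by (simp add: median_convex_def)
    ultimately
    show False
      using E(3) by blast
  qed
  then have "- M = E"
    using E(3) by blast
  then have "M \<in> halfspaces"
    using M(1,2) E assms(4,5) unfolding halfspaces_def by auto
  then show thesis
    using that M by blast
qed

lemma halfspace_separates_points:
  assumes "x \<noteq> (y::'a)"
  obtains h where "h \<in> halfspaces" "x \<in> h" "y \<notin> h"
proof (rule halfspace_separation[of "{x}" "{y}"])
  show "median_convex {x}" "median_convex {y}"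
    by (auto simp: median_convex_def metric_interval_def dist_commute)
qed (use assms in auto)

end

section \<open>Walls and their two sides\<close>

lemma halfspace_Compl: "h \<in> halfspaces \<Longrightarrow> - h \<in> halfspaces"
  by (simp add: halfspaces_def)

lemma mem_halfspace_of_interval:
  assumes "h \<in> halfspaces" "z \<in> metric_interval x y" "x \<in> h" "y \<in> h"
  shows "z \<in> h"
proof -
  have "median_convex h"
    using assms(1) by (simp add: halfspaces_def)
  then show ?thesis
    using assms(2-4) by (auto simp: median_convex_def)
qed

lemma wall_of_eq_iff: "wall_of h = wall_of k \<longleftrightarrow> h = k \<or> h = - k"
  by (auto simp: wall_of_def doubleton_eq_iff)

lemma wall_of_mem_wall_interval:
  "h \<in> halfspaces \<Longrightarrow> wall_of h \<in> wall_interval x y \<longleftrightarrow> (x \<in> h) \<noteq> (y \<in> h)"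
  unfolding wall_interval_def walls_def by (auto simp: wall_of_def)

lemma wall_interval_subset_walls: "wall_interval x y \<subseteq> walls"
  by (auto simp: wall_interval_def)

lemma wall_interval_self [simp]: "wall_interval x x = {}"
  by (auto simp: wall_interval_def)

lemma wall_subsetI:
  assumes "A \<subseteq> walls" "\<And>h. h \<in> halfspaces \<Longrightarrow> wall_of h \<in> A \<Longrightarrow> wall_of h \<in> B"
  shows "A \<subseteq> B"
  using assms unfolding walls_def by blast

subsection \<open>The outer measure\<close>

lemma wall_outer_measure_le:
  "E \<subseteq> (\<Union>n. wall_interval (p n) (q n)) \<Longrightarrow>
    wall_outer_measure E \<le> (\<Sum>n. ennreal (dist (p n) (q n)))"
  unfolding wall_outer_measure_def by (rule INF_lower2[of "(p, q)"]) auto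

lemma wall_outer_measure_close:
  assumes "wall_outer_measure E < e"
  obtains p q where "E \<subseteq> (\<Union>n. wall_interval (p n) (q n))"
    "(\<Sum>n. ennreal (dist (p n) (q n))) < e"
  using assms unfolding wall_outer_measure_def INF_less_iff by auto

lemma wall_outer_measure_mono: "E \<subseteq> F \<Longrightarrow> wall_outer_measure E \<le> wall_outer_measure F"
  unfolding wall_outer_measure_def by (rule INF_superset_mono) auto

lemma wall_outer_measure_empty [simp]: "wall_outer_measure {} = 0"
  using wall_outer_measure_le[of "{}" "\<lambda>_. undefined" "\<lambda>_. undefined"] by simp

lemma wall_outer_measure_interval_le: "wall_outer_measure (wall_interval x y) \<le> ennreal (dist x y)"
proof -
  \<comment> \<open>The interval itself is the term at index 0; the remaining terms are empty
    intervals of length zero.\<close>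
  let ?q = "\<lambda>n::nat. if n = 0 then y else x"
  have "wall_outer_measure (wall_interval x y) \<le> (\<Sum>n. ennreal (dist x (?q n)))"
    by (rule wall_outer_measure_le) auto
  also have "\<dots> = (\<Sum>n\<in>{0}. ennreal (dist x (?q n)))"
    by (intro suminf_finite) auto
  finally show ?thesis by simp
qed

text \<open>Covers of the sets \<open>A n\<close> that are optimal up to \<open>e / 2^(n+1)\<close>
  are merged into one sequence by \<open>prod_decode\<close>; the errors add up to
  \<open>e\<close>.\<close>

lemma wall_outer_measure_subadditive:
  "wall_outer_measure (\<Union>i. A i) \<le> (\<Sum>i. wall_outer_measure (A i :: 'a::metric_space set set set))"
proof (rule ennreal_le_epsilon)
  fix e :: real
  assume e: "0 < e" and fin: "(\<Sum>i. wall_outer_measure (A i)) < top"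
  then have *: "wall_outer_measure (A n) < wall_outer_measure (A n) + ennreal (e * (1/2)^Suc n)" for n
    by (auto simp add: less_top dest!: ennreal_suminf_lessD)
  have "\<exists>p q. A n \<subseteq> (\<Union>i. wall_interval (p i) (q i)) \<and>
      (\<Sum>i. ennreal (dist (p i) (q i))) \<le> wall_outer_measure (A n) + ennreal (e * (1/2)^Suc n)" for n
    by (rule wall_outer_measure_close[OF *[of n]]) (auto intro: less_imp_le)
  then obtain p q where A: "\<And>n. A n \<subseteq> (\<Union>i::nat. wall_interval (p n i) (q n i))"
    and le: "\<And>n. (\<Sum>i::nat. ennreal (dist (p n i) (q n i))) \<le>
      wall_outer_measure (A n) + ennreal (e * (1/2)^Suc n)"
    by metis
  define p' q' where "p' = case_prod p \<circ> prod_decode" and "q' = case_prod q \<circ> prod_decode"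
  have "(\<Union>n. A n) \<subseteq> (\<Union>k. wall_interval (p' k) (q' k))"
  proof
    fix w assume "w \<in> (\<Union>n. A n)"
    then obtain n i where "w \<in> wall_interval (p n i) (q n i)"
      using A by blast
    then have "w \<in> wall_interval (p' (prod_encode (n, i))) (q' (prod_encode (n, i)))"
      by (simp add: p'_def q'_def)
    then show "w \<in> (\<Union>k. wall_interval (p' k) (q' k))" by blast
  qed
  then have "wall_outer_measure (\<Union>n. A n) \<le> (\<Sum>k. ennreal (dist (p' k) (q' k)))"
    by (rule wall_outer_measure_le)
  also have "\<dots> = (\<Sum>k. case_prod (\<lambda>n i. ennreal (dist (p n i) (q n i))) (prod_decode k))"
    by (simp add: p'_def q'_def split_beta)
  also have "\<dots> = (\<Sum>n. \<Sum>i. ennreal (dist (p n i) (q n i)))"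
    by (rule suminf_ennreal_2dimen) simp
  also have "\<dots> \<le> (\<Sum>n. wall_outer_measure (A n) + ennreal (e * (1/2) ^ Suc n))"
    by (intro suminf_le le) auto
  also have "\<dots> = (\<Sum>n. wall_outer_measure (A n)) + (\<Sum>n. ennreal e * ennreal ((1/2) ^ Suc n))"
    using e by (subst suminf_add[symmetric])
      (auto simp del: ennreal_suminf_cmult simp add: ennreal_mult[symmetric])
  also have "\<dots> = (\<Sum>n. wall_outer_measure (A n)) + ennreal e"
    unfolding ennreal_suminf_cmult
    by (subst suminf_ennreal_eq[OF zero_le_power power_half_series]) auto
  finally show "wall_outer_measure (\<Union>n. A n) \<le> (\<Sum>n. wall_outer_measure (A n)) + ennreal e" .
qed

lemma outer_measure_space_wall: "outer_measure_space (Pow walls) wall_outer_measure"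
  unfolding outer_measure_space_def positive_def increasing_def countably_subadditive_def
  using wall_outer_measure_mono wall_outer_measure_subadditive by auto

lemma wall_outer_measure_Un:
  "wall_outer_measure (A \<union> B) \<le> wall_outer_measure A + wall_outer_measure B"
proof -
  have "wall_outer_measure (\<Union>i. binaryset A B i) \<le> (\<Sum>i. wall_outer_measure (binaryset A B i))"
    by (rule wall_outer_measure_subadditive)
  also have "\<dots> = wall_outer_measure A + wall_outer_measure B"
    by (rule suminf_binaryset_eq) simp
  finally show ?thesis
    by (simp add: UN_binaryset_eq)
qed

subsection \<open>Compactness of the Cantor cube\<close>

text \<open>The clopen subsets of the Cantor cube of all subsets of a type: finitely many
  coordinates \<open>F\<close> decide membership. As \<open>A\<close> and \<open>B\<close> may be
  exchanged, the implication amounts to an equivalence.\<close>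

definition finitely_determined :: "'a set set \<Rightarrow> bool" where
  "finitely_determined U \<longleftrightarrow> (\<exists>F. finite F \<and> (\<forall>A B. A \<inter> F = B \<inter> F \<longrightarrow> A \<in> U \<longrightarrow> B \<in> U))"

lemma finitely_determined_Collect:
  assumes "finite F" "\<And>A B. A \<inter> F = B \<inter> F \<Longrightarrow> P A \<Longrightarrow> P B"
  shows "finitely_determined {A. P A}"
  unfolding finitely_determined_def using assms by blast

text \<open>Tychonoff's theorem for a product of two-point discrete spaces, read through the
  correspondence of predicates and sets.\<close>

lemma finitely_determined_compact:
  assumes fd: "\<And>U. U \<in> \<U> \<Longrightarrow> finitely_determined U" and cover: "\<Union>\<U> = (UNIV :: 'a set set)"
  obtains \<V> where "finite \<V>" "\<V> \<subseteq> \<U>" "\<Union>\<V> = UNIV"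
proof -
  let ?T = "product_topology (\<lambda>_::'a. discrete_topology (UNIV :: bool set)) UNIV"
  have top: "topspace ?T = UNIV"
    by simp
  have "compact_space ?T"
    by (simp add: compact_space_product_topology compact_space_discrete_topology)
  have op: "openin ?T {P. {x. P x} \<in> U}" if "U \<in> \<U>" for U
  proof (subst openin_subopen, intro ballI)
    fix P assume P: "P \<in> {P. {x. P x} \<in> U}"
    obtain F where F: "finite F" "\<And>A B. A \<inter> F = B \<inter> F \<Longrightarrow> A \<in> U \<Longrightarrow> B \<in> U"
      using fd[OF \<open>U \<in> \<U>\<close>] unfolding finitely_determined_def by blast
    \<comment> \<open>The cylinder of all predicates agreeing with \<open>P\<close> on
      \<open>F\<close> is a basic neighbourhood of \<open>P\<close>.\<close>
    let ?B = "\<Pi>\<^sub>E i\<in>UNIV. if i \<in> F then {P i} else UNIV"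
    have "openin ?T ?B"
    proof (rule product_topology_basis)
      have "{i. (if i \<in> F then {P i} else UNIV) \<noteq> UNIV} \<subseteq> F"
        by auto
      then show "finite {i. (if i \<in> F then {P i} else UNIV) \<noteq> topspace (discrete_topology UNIV)}"
        using F(1) by (simp add: finite_subset)
    qed auto
    moreover have "P \<in> ?B"
      by auto
    moreover have "?B \<subseteq> {P. {x. P x} \<in> U}"
    proof
      fix Q assume "Q \<in> ?B"
      then have "Q i = P i" if "i \<in> F" for i
        using that by (auto simp: PiE_iff split: if_splits)
      then have "{x. P x} \<inter> F = {x. Q x} \<inter> F"
        by auto
      then show "Q \<in> {P. {x. P x} \<in> U}"
        using F(2)[of "{x. P x}" "{x. Q x}"] P by simp
    qed
    ultimately show "\<exists>T. openin ?T T \<and> P \<in> T \<and> T \<subseteq> {P. {x. P x} \<in> U}"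
      by blast
  qed
  let ?f = "\<lambda>U. {P. {x. P x} \<in> U}"
  have "P \<in> \<Union>(?f ` \<U>)" for P
  proof -
    have "{x. P x} \<in> \<Union>\<U>"
      unfolding cover by simp
    then show ?thesis
      by simp
  qed
  then have "topspace ?T \<subseteq> \<Union>(?f ` \<U>)"
    by (intro subsetI)
  moreover have "\<forall>W\<in>?f ` \<U>. openin ?T W"
    using op by simp
  ultimately obtain \<F> where \<F>: "finite \<F>" "\<F> \<subseteq> ?f ` \<U>" "topspace ?T \<subseteq> \<Union>\<F>"
    using \<open>compact_space ?T\<close>[unfolded compact_space_alt, THEN spec, of "?f ` \<U>"] by (elim impE exE conjE) auto
  obtain \<V> where \<V>: "\<V> \<subseteq> \<U>" "finite \<V>" and "\<F> = ?f ` \<V>"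
    using finite_subset_image[OF \<F>(1,2)] by (elim exE conjE)
  with \<F>(3) have sub: "UNIV \<subseteq> \<Union>(?f ` \<V>)"
    unfolding top by simp
  have "A \<in> \<Union>\<V>" for A
  proof -
    have "(\<lambda>x. x \<in> A) \<in> \<Union>(?f ` \<V>)"
      by (rule subsetD[OF sub UNIV_I])
    then show ?thesis by simp
  qed
  then have "\<Union>\<V> = UNIV"
    by (intro UNIV_eq_I[symmetric])
  then show thesis
    by (rule that[OF \<V>(2,1)])
qed

lemma halfspaces_between_compact:
  fixes U :: "'i \<Rightarrow> 'a::metric_space set set"
  assumes fd: "\<And>i. i \<in> I \<Longrightarrow> finitely_determined (U i)"
    and cover: "\<And>h. h \<in> halfspaces \<Longrightarrow> p \<notin> h \<Longrightarrow> q \<in> h \<Longrightarrow> \<exists>i\<in>I. h \<in> U i"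
  obtains J where "finite J" "J \<subseteq> I"
    "\<And>h. h \<in> halfspaces \<Longrightarrow> p \<notin> h \<Longrightarrow> q \<in> h \<Longrightarrow> \<exists>i\<in>J. h \<in> U i"
proof -
  \<comment> \<open>These clopen sets cover exactly the subsets that are not halfspaces with
    \<open>p\<close> outside and \<open>q\<close> inside: in the last kind, \<open>x\<close> and
    \<open>y\<close> are on one side and a point \<open>z\<close> between them is on the other.
    Together with the \<open>U i\<close> they cover the whole cube.\<close>
  define \<N> :: "'a set set set" where "\<N> = {{h. p \<in> h}, {h. q \<notin> h}} \<union>
    {{h. (x \<in> h \<longleftrightarrow> y \<in> h) \<and> (z \<in> h \<longleftrightarrow> x \<notin> h)} | x y z. z \<in> metric_interval x y}"
  have fdN: "finitely_determined V" if V: "V \<in> \<N>" for V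
  proof -
    consider "V = {h. p \<in> h}" | "V = {h. q \<notin> h}"
      | x y z where "V = {h. (x \<in> h \<longleftrightarrow> y \<in> h) \<and> (z \<in> h \<longleftrightarrow> x \<notin> h)}"
      using V unfolding \<N>_def by blast
    then show ?thesis
    proof cases
      case 1
      then show ?thesis
        by (auto intro!: finitely_determined_Collect[of "{p}"])
    next
      case 2
      then show ?thesis
        by (auto intro!: finitely_determined_Collect[of "{q}"])
    next
      case (3 x y z)
      show ?thesis
        unfolding 3 by (rule finitely_determined_Collect[of "{x, y, z}"]) (simp, blast)
    qed
  qed
  have notin_N: "h \<notin> V" if V: "V \<in> \<N>" and h: "h \<in> halfspaces" "p \<notin> h" "q \<in> h" for h V
    using V unfolding \<N>_def
  proof (elim UnE insertE CollectE exE conjE emptyE)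
    fix x y z assume z: "z \<in> metric_interval x y"
      and V: "V = {h. (x \<in> h \<longleftrightarrow> y \<in> h) \<and> (z \<in> h \<longleftrightarrow> x \<notin> h)}"
    have "x \<in> h \<Longrightarrow> y \<in> h \<Longrightarrow> z \<in> h" "x \<notin> h \<Longrightarrow> y \<notin> h \<Longrightarrow> z \<notin> h"
      using mem_halfspace_of_interval[OF h(1) z] mem_halfspace_of_interval[OF halfspace_Compl[OF h(1)] z]
      by simp_all
    then show ?thesis
      unfolding V by blast
  qed (use h in simp_all)
  have in_N: "h \<in> halfspaces \<and> p \<notin> h \<and> q \<in> h" if h: "\<And>V. V \<in> \<N> \<Longrightarrow> h \<notin> V" for h
  proof -
    have pq: "p \<notin> h" "q \<in> h"
      using h[of "{h. p \<in> h}"] h[of "{h. q \<notin> h}"] unfolding \<N>_def by simp_all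
    have *: "z \<in> h \<longleftrightarrow> x \<in> h" if "z \<in> metric_interval x y" "x \<in> h \<longleftrightarrow> y \<in> h" for x y z
    proof -
      have "{h. (x \<in> h \<longleftrightarrow> y \<in> h) \<and> (z \<in> h \<longleftrightarrow> x \<notin> h)} \<in> \<N>"
        unfolding \<N>_def
        by (intro UnI2 CollectI exI[of _ x] exI[of _ y] exI[of _ z] conjI refl that(1))
      from h[OF this] show ?thesis
        using that(2) by simp
    qed
    have "median_convex h"
      unfolding median_convex_def
    proof (intro ballI subsetI)
      fix x y z assume "x \<in> h" "y \<in> h" "z \<in> metric_interval x y"
      then show "z \<in> h"
        using *[of z x y] by simp
    qed
    moreover have "median_convex (- h)"
      unfolding median_convex_def
    proof (intro ballI subsetI)
      fix x y z assume "x \<in> - h" "y \<in> - h" "z \<in> metric_interval x y"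
      then show "z \<in> - h"
        using *[of z x y] by simp
    qed
    ultimately show ?thesis
      using pq unfolding halfspaces_def by auto
  qed
  have "h \<in> \<Union>(\<N> \<union> U ` I)" for h
    using in_N[of h] cover[of h] by (cases "\<exists>V\<in>\<N>. h \<in> V") auto
  then have "\<Union>(\<N> \<union> U ` I) = UNIV"
    by auto
  moreover have "finitely_determined V" if "V \<in> \<N> \<union> U ` I" for V
    using that fdN fd by (elim UnE imageE) simp_all
  ultimately obtain \<V> where \<V>: "finite \<V>" "\<V> \<subseteq> \<N> \<union> U ` I" "\<Union>\<V> = UNIV"
    using finitely_determined_compact[of "\<N> \<union> U ` I"] by metis
  have "finite (\<V> - \<N>)" "\<V> - \<N> \<subseteq> U ` I"
    using \<V>(1,2) by auto
  then obtain J where J: "J \<subseteq> I" "finite J" "\<V> - \<N> = U ` J"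
    by (meson finite_subset_image)
  show thesis
  proof (rule that[OF J(2,1)])
    fix h assume h: "h \<in> halfspaces" "p \<notin> h" "q \<in> h"
    have "h \<in> \<Union>\<V>"
      unfolding \<V>(3) by simp
    then obtain V where "V \<in> \<V>" "h \<in> V"
      by (rule UnionE)
    moreover have "V \<notin> \<N>"
      using notin_N[OF _ h] \<open>h \<in> V\<close> by blast
    ultimately show "\<exists>i\<in>J. h \<in> U i"
      using J(3) by (metis DiffI imageE)
  qed
qed

subsection \<open>The measure of a wall-interval\<close>

context median_metric
begin

text \<open>Majority vote: two points on one side of a wall force the median, which lies between
  them, to the same side. Applied to \<open>h\<close> and to its complement, this gives both
  directions.\<close>

lemma med_mem_halfspace_iff:
  assumes "h \<in> halfspaces"
  shows "med x y z \<in> h \<longleftrightarrow> x \<in> h \<and> y \<in> h \<or> y \<in> h \<and> z \<in> h \<or> x \<in> h \<and> (z::'a) \<in> h"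
proof -
  have *: "med x y z \<in> k" if "k \<in> halfspaces" "x \<in> k \<and> y \<in> k \<or> y \<in> k \<and> z \<in> k \<or> x \<in> k \<and> z \<in> k" for k
    using that med_in_intervals[of x y z] mem_halfspace_of_interval by metis
  show ?thesis
    using *[OF assms] *[OF halfspace_Compl[OF assms]]
    by (cases "x \<in> h"; cases "y \<in> h"; cases "z \<in> h") simp_all
qed

lemma in_interval_iff_halfspaces:
  "z \<in> metric_interval x (y::'a) \<longleftrightarrow> (\<forall>h\<in>halfspaces. x \<in> h \<longrightarrow> y \<in> h \<longrightarrow> z \<in> h)"
proof
  assume "z \<in> metric_interval x y"
  then show "\<forall>h\<in>halfspaces. x \<in> h \<longrightarrow> y \<in> h \<longrightarrow> z \<in> h"
    using mem_halfspace_of_interval by blast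
next
  assume *: "\<forall>h\<in>halfspaces. x \<in> h \<longrightarrow> y \<in> h \<longrightarrow> z \<in> h"
  have "med x y z = z"
  proof (rule ccontr)
    assume "med x y z \<noteq> z"
    then obtain h where h: "h \<in> halfspaces" "med x y z \<in> h" "z \<notin> h"
      by (rule halfspace_separates_points)
    then show False
      using *[THEN bspec, OF h(1)] med_mem_halfspace_iff[OF h(1), of x y z] by simp
  qed
  then show "z \<in> metric_interval x y"
    by (simp add: med_eq_iff)
qed

text \<open>The points \<open>r\<close> and \<open>s\<close> arise by projecting \<open>p\<close>
  and \<open>q\<close> to the interval from \<open>x\<close> to \<open>y\<close> and then back. The
  walls separating both pairs end up between \<open>r\<close> and \<open>s\<close>, and the other
  walls between \<open>p\<close> and \<open>q\<close> in the two outer segments.\<close>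

lemma interval_trisection:
  fixes p q x y :: 'a
  defines "r \<equiv> med p q (med x y p)" and "s \<equiv> med p q (med x y q)"
  shows "dist p q = dist p r + dist r s + dist s q"
    and "wall_interval p q \<inter> wall_interval x y \<subseteq> wall_interval r s"
    and "wall_interval p q - wall_interval x y \<subseteq> wall_interval p r \<union> wall_interval s q"
    and "wall_interval p r \<subseteq> wall_interval p q - wall_interval x y"
    and "wall_interval s q \<subseteq> wall_interval p q - wall_interval x y"
    and "dist r s \<le> dist (med x y p) (med x y q)"
proof -
  \<comment> \<open>Two rounds of majority vote: across a wall separating \<open>x\<close> and
    \<open>y\<close>, \<open>r\<close> follows \<open>p\<close> and \<open>s\<close> follows
    \<open>q\<close>; if the wall separates only \<open>p\<close> and \<open>q\<close>, both follow
    \<open>x\<close>.\<close>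
  have h: "r \<in> h \<longleftrightarrow> (if (p \<in> h) = (q \<in> h) \<or> (x \<in> h) \<noteq> (y \<in> h) then p \<in> h else x \<in> h)"
    "s \<in> h \<longleftrightarrow> (if (p \<in> h) = (q \<in> h) \<or> (x \<in> h) \<noteq> (y \<in> h) then q \<in> h else x \<in> h)"
    if "h \<in> halfspaces" for h
    unfolding r_def s_def med_mem_halfspace_iff[OF that]
    by (cases "p \<in> h"; cases "q \<in> h"; cases "x \<in> h"; cases "y \<in> h"; simp)+
  have "r \<in> metric_interval p s" "s \<in> metric_interval p q"
    unfolding in_interval_iff_halfspaces by (simp_all add: h)
  then show "dist p q = dist p r + dist r s + dist s q"
    unfolding in_interval_iff by linarith
  show "wall_interval p q \<inter> wall_interval x y \<subseteq> wall_interval r s"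
    "wall_interval p q - wall_interval x y \<subseteq> wall_interval p r \<union> wall_interval s q"
    "wall_interval p r \<subseteq> wall_interval p q - wall_interval x y"
    "wall_interval s q \<subseteq> wall_interval p q - wall_interval x y"
    by (rule wall_subsetI, use wall_interval_subset_walls in blast,
        (auto simp: wall_of_mem_wall_interval h split: if_splits)[1])+
  show "dist r s \<le> dist (med x y p) (med x y q)"
    unfolding r_def s_def by (rule med_lipschitz)
qed

text \<open>Trisect each interval of a cover of \<open>E\<close>: the middle segments cover the part
  inside the wall-interval, the outer ones cover the part outside, and the total length is
  unchanged.\<close>

lemma wall_interval_caratheodory:
  "wall_outer_measure (E \<inter> wall_interval x y) + wall_outer_measure (E - wall_interval x (y::'a))
     \<le> wall_outer_measure E"
proof -
  let ?\<mu> = wall_outer_measure and ?W = "wall_interval x y"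
  have "?\<mu> (E \<inter> ?W) + ?\<mu> (E - ?W) \<le> (\<Sum>n. ennreal (dist (p n) (q n)))"
    if cover: "E \<subseteq> (\<Union>n::nat. wall_interval (p n) (q n))" for p q
  proof -
    define r s where "r n = med (p n) (q n) (med x y (p n))"
      and "s n = med (p n) (q n) (med x y (q n))" for n
    note tri = interval_trisection[of "p n" "q n" x y for n, folded r_def s_def]
    have 1: "E \<inter> ?W \<subseteq> (\<Union>n. wall_interval (r n) (s n))"
    proof
      fix w assume w: "w \<in> E \<inter> ?W"
      then obtain n where "w \<in> wall_interval (p n) (q n)"
        using cover by auto
      then show "w \<in> (\<Union>n. wall_interval (r n) (s n))"
        using w tri(2)[of n] by auto
    qed
    have 2: "E - ?W \<subseteq> (\<Union>n. wall_interval (p n) (r n)) \<union> (\<Union>n. wall_interval (s n) (q n))"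
    proof
      fix w assume w: "w \<in> E - ?W"
      then obtain n where "w \<in> wall_interval (p n) (q n)"
        using cover by auto
      then show "w \<in> (\<Union>n. wall_interval (p n) (r n)) \<union> (\<Union>n. wall_interval (s n) (q n))"
        using w tri(3)[of n] by auto
    qed
    have "?\<mu> (E - ?W) \<le> ?\<mu> (\<Union>n. wall_interval (p n) (r n)) + ?\<mu> (\<Union>n. wall_interval (s n) (q n))"
      using wall_outer_measure_mono[OF 2] wall_outer_measure_Un by (rule order_trans)
    also have "\<dots> \<le> (\<Sum>n. ennreal (dist (p n) (r n))) + (\<Sum>n. ennreal (dist (s n) (q n)))"
      by (intro add_mono wall_outer_measure_le order_refl)
    finally have "?\<mu> (E \<inter> ?W) + ?\<mu> (E - ?W) \<le> (\<Sum>n. ennreal (dist (r n) (s n))) +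
        ((\<Sum>n. ennreal (dist (p n) (r n))) + (\<Sum>n. ennreal (dist (s n) (q n))))"
      by (intro add_mono wall_outer_measure_le[OF 1])
    also have "\<dots> = (\<Sum>n. ennreal (dist (r n) (s n)) +
        (ennreal (dist (p n) (r n)) + ennreal (dist (s n) (q n))))"
      by (simp add: suminf_add)
    also have "\<dots> = (\<Sum>n. ennreal (dist (p n) (q n)))"
      using tri(1) by (simp flip: ennreal_plus add: ac_simps)
    finally show ?thesis .
  qed
  then show ?thesis
    unfolding wall_outer_measure_def[of E] by (intro INF_greatest) auto
qed

lemma wall_measure_facts:
  shows sets_wall_measure: "sets (wall_measure :: 'a set set measure)
      = sigma_sets walls {wall_interval x y | x y. True}"
    and space_wall_measure: "space (wall_measure :: 'a set set measure) = walls"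
    and emeasure_wall_measure: "E \<in> sets (wall_measure :: 'a set set measure) \<Longrightarrow>
      emeasure wall_measure E = wall_outer_measure E"
proof -
  let ?G = "{wall_interval x y | x y :: 'a. True}"
  have G: "?G \<subseteq> Pow walls"
    using wall_interval_subset_walls by blast
  show sets: "sets (wall_measure :: 'a set set measure) = sigma_sets walls ?G"
    unfolding wall_measure_def using G by (rule sets_measure_of)
  show "space (wall_measure :: 'a set set measure) = walls"
    unfolding wall_measure_def using G by (rule space_measure_of)
  \<comment> \<open>The sets that split every set of walls additively. The outer measure is a
    measure on them, and they contain the wall-intervals, hence the generated sigma-algebra.\<close>
  let ?L = "lambda_system walls (Pow walls) (wall_outer_measure :: 'a set set set \<Rightarrow> ennreal)"
  have L: "measure_space walls ?L wall_outer_measure"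
    by (rule sigma_algebra.caratheodory_lemma[OF sigma_algebra_Pow outer_measure_space_wall])
  have "?G \<subseteq> ?L"
  proof
    fix W assume "W \<in> ?G"
    then obtain x y where W: "W = wall_interval x y" by blast
    have "wall_outer_measure (E \<inter> W) + wall_outer_measure (E - W) = wall_outer_measure E" for E
    proof (rule antisym)
      have "wall_outer_measure E \<le> wall_outer_measure ((E \<inter> W) \<union> (E - W))"
        by (rule wall_outer_measure_mono) auto
      also have "\<dots> \<le> wall_outer_measure (E \<inter> W) + wall_outer_measure (E - W)"
        by (rule wall_outer_measure_Un)
      finally show "wall_outer_measure E \<le> wall_outer_measure (E \<inter> W) + wall_outer_measure (E - W)" .
    qed (use wall_interval_caratheodory W in simp)
    then show "W \<in> ?L"
      using W wall_interval_subset_walls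
      by (simp add: algebra.lambda_system_eq[OF algebra_Pow])
  qed
  then have "sigma_sets walls ?G \<subseteq> ?L"
    using L by (intro sigma_algebra.sigma_sets_subset) (auto simp: measure_space_def)
  then have "measure_space walls (sigma_sets walls ?G) (wall_outer_measure :: 'a set set set \<Rightarrow> ennreal)"
    by (intro measure_down[OF L] sigma_algebra_sigma_sets G)
  then show "emeasure wall_measure E = wall_outer_measure E"
    if "E \<in> sets (wall_measure :: 'a set set measure)"
    using emeasure_measure_of[OF wall_measure_def G _ _ that] unfolding sets measure_space_def
    by blast
qed

lemma wall_interval_in_sets [measurable]: "wall_interval x (y::'a) \<in> sets wall_measure"
  unfolding sets_wall_measure by (rule sigma_sets.Basic) blast

section \<open>The lower bound for the outer measure of a wall-interval\<close>

lemma dist_med_additive: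
  fixes p q x y z :: 'a
  assumes "z \<in> metric_interval x y"
  shows "dist (med p q x) (med p q y) = dist (med p q x) (med p q z) + dist (med p q z) (med p q y)"
  using med_preserves_interval[OF assms] by (simp add: in_interval_iff)

text \<open>The bound uses projected lengths because these are additive along \<open>x\<close>,
  \<open>r\<close>, \<open>s\<close>, \<open>y\<close>, which drives the induction. The interval of
  \<open>i\<close> accounts for the middle segment; the walls of the outer segments avoid it, so
  they are covered by the intervals of \<open>J\<close>.\<close>

lemma finite_cover_dist_le:
  fixes p q :: "'i \<Rightarrow> 'a"
  assumes "finite J" "wall_interval x y \<subseteq> (\<Union>j\<in>J. wall_interval (p j) (q j))"
  shows "dist x y \<le> (\<Sum>j\<in>J. dist (med (p j) (q j) x) (med (p j) (q j) y))"
  using assms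
proof (induction J arbitrary: x y)
  case empty
  have "x = y"
  proof (rule ccontr)
    assume "x \<noteq> y"
    then obtain h where "h \<in> halfspaces" "x \<in> h" "y \<notin> h"
      by (rule halfspace_separates_points)
    then have "wall_of h \<in> wall_interval x y"
      by (simp add: wall_of_mem_wall_interval)
    then show False
      using empty by simp
  qed
  then show ?case by simp
next
  case (insert i J)
  define F where "F a b = (\<Sum>j\<in>J. dist (med (p j) (q j) a) (med (p j) (q j) b))" for a b
  define r s where "r = med x y (med (p i) (q i) x)" and "s = med x y (med (p i) (q i) y)"
  note tri = interval_trisection[of x y "p i" "q i", folded r_def s_def]
  have "dist x r \<le> F x r" "dist s y \<le> F s y"
    unfolding F_def using tri(4,5) insert.prems by (intro insert.IH; blast)+
  moreover have "F x y \<ge> F x r + F s y"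
  proof -
    have r: "r \<in> metric_interval x s" and s: "s \<in> metric_interval x y"
      using tri(1) dist_triangle[of x y s] dist_triangle[of x s r] unfolding in_interval_iff
      by linarith+
    show ?thesis
      unfolding F_def sum.distrib[symmetric]
      by (intro sum_mono) (simp add: dist_med_additive[OF r] dist_med_additive[OF s])
  qed
  ultimately show ?case
    using tri(1,6) insert.hyps unfolding F_def by simp
qed

theorem wall_outer_measure_interval: "wall_outer_measure (wall_interval x y) = ennreal (dist x (y::'a))"
proof (rule antisym[OF wall_outer_measure_interval_le])
  have "ennreal (dist x y) \<le> (\<Sum>n. ennreal (dist (p n) (q n)))"
    if cover: "wall_interval x y \<subseteq> (\<Union>n::nat. wall_interval (p n) (q n))" for p q
  proof -
    have "finitely_determined {h. (p n \<in> h) \<noteq> (q n \<in> h)}" for n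
      by (rule finitely_determined_Collect[of "{p n, q n}"]) (simp, blast)
    moreover have "\<exists>n\<in>UNIV. h \<in> {h. (p n \<in> h) \<noteq> (q n \<in> h)}"
      if "h \<in> halfspaces" "x \<notin> h" "y \<in> h" for h
    proof -
      have "wall_of h \<in> wall_interval x y"
        using that by (simp add: wall_of_mem_wall_interval)
      then obtain n where "wall_of h \<in> wall_interval (p n) (q n)"
        using cover by auto
      then show ?thesis
        using that(1) by (auto simp: wall_of_mem_wall_interval)
    qed
    ultimately obtain J where J: "finite J"
      "\<And>h. h \<in> halfspaces \<Longrightarrow> x \<notin> h \<Longrightarrow> y \<in> h \<Longrightarrow> \<exists>n\<in>J. h \<in> {h. (p n \<in> h) \<noteq> (q n \<in> h)}"
      by (rule halfspaces_between_compact[of UNIV "\<lambda>n. {h. (p n \<in> h) \<noteq> (q n \<in> h)}" x y]) auto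
    have "wall_interval x y \<subseteq> (\<Union>n\<in>J. wall_interval (p n) (q n))"
    proof (rule wall_subsetI[OF wall_interval_subset_walls])
      fix h :: "'a set" assume h: "h \<in> halfspaces" "wall_of h \<in> wall_interval x y"
      \<comment> \<open>Exactly one side of the wall contains \<open>y\<close> but not
        \<open>x\<close>; the finite subcover is applied to that side.\<close>
      then have "x \<notin> h \<and> y \<in> h \<or> x \<notin> - h \<and> y \<in> - h"
        by (auto simp: wall_of_mem_wall_interval)
      then show "wall_of h \<in> (\<Union>n\<in>J. wall_interval (p n) (q n))"
        using J(2)[of h] J(2)[of "- h"] h(1) halfspace_Compl by (auto simp: wall_of_mem_wall_interval)
    qed
    then have "dist x y \<le> (\<Sum>n\<in>J. dist (med (p n) (q n) x) (med (p n) (q n) y))"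
      by (rule finite_cover_dist_le[OF J(1)])
    also have "\<dots> \<le> (\<Sum>n\<in>J. dist (p n) (q n))"
      by (intro sum_mono dist_le_of_mem_interval med_in_intervals)
    finally have "ennreal (dist x y) \<le> (\<Sum>n\<in>J. ennreal (dist (p n) (q n)))"
      by (simp add: ennreal_leI)
    also have "\<dots> \<le> (\<Sum>n. ennreal (dist (p n) (q n)))"
      using J(1) by (intro sum_le_suminf) auto
    finally show ?thesis .
  qed
  then show "ennreal (dist x y) \<le> wall_outer_measure (wall_interval x y)"
    unfolding wall_outer_measure_def by (intro INF_greatest) auto
qed

end

lemma wall_eqI:
  assumes "A \<subseteq> walls" "B \<subseteq> walls" "\<And>h. h \<in> halfspaces \<Longrightarrow> wall_of h \<in> A \<longleftrightarrow> wall_of h \<in> B"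
  shows "A = B"
  using wall_subsetI[of A B] wall_subsetI[of B A] assms by auto

subsection \<open>Ultrafilters\<close>

text \<open>For ultrafilters, the symmetric difference is closed under complements, so it is the
  full preimage of this set of walls. For point ultrafilters the set is a wall-interval.\<close>

definition separating_walls :: "'a::metric_space set set \<Rightarrow> 'a set set \<Rightarrow> 'a set set set" where
  "separating_walls \<sigma> \<tau> = wall_of ` sym_diff \<sigma> \<tau>"

lemma ultrafilter_Compl_iff:
  assumes "halfspace_ultrafilter \<sigma>" "h \<in> halfspaces"
  shows "- h \<in> \<sigma> \<longleftrightarrow> h \<notin> \<sigma>"
proof -
  have "h \<in> \<sigma> \<or> - h \<in> \<sigma>"
    using assms unfolding halfspace_ultrafilter_def by simp
  moreover have "h \<inter> - h \<noteq> {}" if "h \<in> \<sigma>" "- h \<in> \<sigma>"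
    using assms(1) that unfolding halfspace_ultrafilter_def by meson
  ultimately show ?thesis
    by auto
qed

lemma point_ultrafilter: "halfspace_ultrafilter (point_ultrafilter x)"
  unfolding halfspace_ultrafilter_def point_ultrafilter_def using halfspace_Compl by auto

lemma mem_point_ultrafilter: "h \<in> halfspaces \<Longrightarrow> h \<in> point_ultrafilter x \<longleftrightarrow> x \<in> h"
  by (simp add: point_ultrafilter_def)

lemma wall_of_mem_separating_walls:
  assumes "halfspace_ultrafilter \<sigma>" "halfspace_ultrafilter \<tau>" "h \<in> halfspaces"
  shows "wall_of h \<in> separating_walls \<sigma> \<tau> \<longleftrightarrow> (h \<in> \<sigma>) \<noteq> (h \<in> \<tau>)"
proof -
  have "wall_of h \<in> separating_walls \<sigma> \<tau> \<longleftrightarrow> h \<in> sym_diff \<sigma> \<tau> \<or> - h \<in> sym_diff \<sigma> \<tau>"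
    unfolding separating_walls_def image_iff wall_of_eq_iff by (metis double_complement)
  then show ?thesis
    using ultrafilter_Compl_iff[OF assms(1,3)] ultrafilter_Compl_iff[OF assms(2,3)] by auto
qed

lemma separating_walls_subset_walls:
  assumes "halfspace_ultrafilter \<sigma>" "halfspace_ultrafilter \<tau>"
  shows "separating_walls \<sigma> \<tau> \<subseteq> walls"
  using assms unfolding separating_walls_def walls_def halfspace_ultrafilter_def
  by (intro image_mono) auto

lemma separating_walls_commute: "separating_walls \<sigma> \<tau> = separating_walls \<tau> \<sigma>"
  by (simp add: separating_walls_def Un_commute)

lemma separating_walls_points:
  "separating_walls (point_ultrafilter x) (point_ultrafilter y) = wall_interval x y"
  by (rule wall_eqI)
    (simp_all add: separating_walls_subset_walls wall_interval_subset_walls point_ultrafilter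
      wall_of_mem_separating_walls wall_of_mem_wall_interval mem_point_ultrafilter)

text \<open>This transfers measurability from pairs containing the base point to arbitrary
  pairs.\<close>

lemma separating_walls_sym_diff:
  assumes "halfspace_ultrafilter \<sigma>" "halfspace_ultrafilter \<tau>" "halfspace_ultrafilter \<upsilon>"
  shows "separating_walls \<sigma> \<tau> = sym_diff (separating_walls \<sigma> \<upsilon>) (separating_walls \<tau> \<upsilon>)"
proof (rule wall_eqI)
  show "sym_diff (separating_walls \<sigma> \<upsilon>) (separating_walls \<tau> \<upsilon>) \<subseteq> walls"
    using separating_walls_subset_walls[OF assms(1,3)] separating_walls_subset_walls[OF assms(2,3)]
    by auto
qed (auto simp: assms separating_walls_subset_walls wall_of_mem_separating_walls)

lemma separating_walls_triangle:
  assumes "halfspace_ultrafilter \<sigma>" "halfspace_ultrafilter \<tau>" "halfspace_ultrafilter \<upsilon>"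
  shows "separating_walls \<sigma> \<tau> \<subseteq> separating_walls \<sigma> \<upsilon> \<union> separating_walls \<upsilon> \<tau>"
  using separating_walls_sym_diff[OF assms] separating_walls_commute[of \<tau> \<upsilon>] by auto

lemma wall_of_vimage_separating_walls:
  assumes "halfspace_ultrafilter \<sigma>" "halfspace_ultrafilter \<tau>"
  shows "wall_of -` separating_walls \<sigma> \<tau> \<inter> halfspaces = sym_diff \<sigma> \<tau>"
proof -
  have "\<sigma> \<subseteq> halfspaces" "\<tau> \<subseteq> halfspaces"
    using assms unfolding halfspace_ultrafilter_def by auto
  then show ?thesis
    using wall_of_mem_separating_walls[OF assms] by auto
qed

lemma halfspace_measure_sym_diff:
  "halfspace_measure (sym_diff \<sigma> \<tau>) = emeasure wall_measure (separating_walls \<sigma> \<tau>)"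
  by (simp add: halfspace_measure_def separating_walls_def)

section \<open>The pseudo-metric on admissible ultrafilters\<close>

context median_metric
begin

lemma sym_diff_in_halfspace_algebra_iff:
  fixes \<sigma> \<tau> :: "'a set set"
  assumes "halfspace_ultrafilter \<sigma>" "halfspace_ultrafilter \<tau>"
  shows "sym_diff \<sigma> \<tau> \<in> halfspace_algebra \<longleftrightarrow> separating_walls \<sigma> \<tau> \<in> sets wall_measure"
proof
  assume "sym_diff \<sigma> \<tau> \<in> halfspace_algebra"
  then obtain E where E: "E \<in> sets wall_measure" "sym_diff \<sigma> \<tau> = wall_of -` E \<inter> halfspaces"
    unfolding halfspace_algebra_def by auto
  have "E \<subseteq> walls"
    using sets.sets_into_space[OF E(1)] by (simp add: space_wall_measure)
  have "separating_walls \<sigma> \<tau> = E"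
  proof (rule wall_eqI[OF separating_walls_subset_walls[OF assms] \<open>E \<subseteq> walls\<close>])
    fix h :: "'a set" assume h: "h \<in> halfspaces"
    have "wall_of h \<in> separating_walls \<sigma> \<tau> \<longleftrightarrow> h \<in> sym_diff \<sigma> \<tau>"
      unfolding wall_of_mem_separating_walls[OF assms h] by auto
    then show "wall_of h \<in> separating_walls \<sigma> \<tau> \<longleftrightarrow> wall_of h \<in> E"
      using h by (simp add: E(2))
  qed
  then show "separating_walls \<sigma> \<tau> \<in> sets wall_measure"
    using E(1) by simp
next
  assume "separating_walls \<sigma> \<tau> \<in> sets wall_measure"
  then show "sym_diff \<sigma> \<tau> \<in> halfspace_algebra"
    unfolding halfspace_algebra_def wall_of_vimage_separating_walls[OF assms, symmetric] by blast
qed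

lemma admissible_iff:
  fixes x :: 'a
  shows "admissible x \<sigma> \<longleftrightarrow> halfspace_ultrafilter \<sigma> \<and>
    separating_walls \<sigma> (point_ultrafilter x) \<in> sets wall_measure \<and>
    emeasure wall_measure (separating_walls \<sigma> (point_ultrafilter x)) < \<infinity>"
  unfolding admissible_def halfspace_measure_sym_diff
  using sym_diff_in_halfspace_algebra_iff[OF _ point_ultrafilter] by blast

lemma separating_walls_in_sets:
  fixes x :: 'a
  assumes "admissible x \<sigma>" "admissible x \<tau>"
  shows "separating_walls \<sigma> \<tau> \<in> sets wall_measure"
  using assms unfolding admissible_iff
  by (subst separating_walls_sym_diff[OF _ _ point_ultrafilter[of x]]) auto

lemma wall_outer_measure_triangle:
  fixes \<sigma> \<tau> \<upsilon> :: "'a set set"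
  assumes "halfspace_ultrafilter \<sigma>" "halfspace_ultrafilter \<tau>" "halfspace_ultrafilter \<upsilon>"
  shows "wall_outer_measure (separating_walls \<sigma> \<tau>)
    \<le> wall_outer_measure (separating_walls \<sigma> \<upsilon>) + wall_outer_measure (separating_walls \<upsilon> \<tau>)"
  using wall_outer_measure_mono[OF separating_walls_triangle[OF assms]] wall_outer_measure_Un
  by (rule order_trans)

text \<open>Both ultrafilters are at finite distance from the base point, so the triangle inequality
  keeps the measure finite and \<open>enn2real\<close> loses nothing.\<close>

lemma ennreal_ultrafilter_dist:
  fixes x :: 'a
  assumes "admissible x \<sigma>" "admissible x \<tau>"
  shows "ennreal (ultrafilter_dist \<sigma> \<tau>) = wall_outer_measure (separating_walls \<sigma> \<tau>)"
proof -
  let ?x = "point_ultrafilter x"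
  have "wall_outer_measure (separating_walls \<sigma> ?x) < \<infinity>" "wall_outer_measure (separating_walls ?x \<tau>) < \<infinity>"
    using assms emeasure_wall_measure separating_walls_commute unfolding admissible_iff by metis+
  then have "wall_outer_measure (separating_walls \<sigma> ?x) + wall_outer_measure (separating_walls ?x \<tau>) < \<infinity>"
    by simp
  then have "wall_outer_measure (separating_walls \<sigma> \<tau>) < \<infinity>"
    using wall_outer_measure_triangle[of \<sigma> \<tau> ?x] assms point_ultrafilter unfolding admissible_iff
    by (meson order.strict_trans1)
  then show ?thesis
    by (simp add: ultrafilter_dist_def halfspace_measure_sym_diff
        emeasure_wall_measure separating_walls_in_sets[OF assms])
qed

lemma ultrafilter_dist_nonneg: "0 \<le> ultrafilter_dist \<sigma> \<tau>"
  by (simp add: ultrafilter_dist_def)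

lemma ultrafilter_dist_commute: "ultrafilter_dist \<sigma> \<tau> = ultrafilter_dist \<tau> \<sigma>"
  by (simp add: ultrafilter_dist_def Un_commute)

lemma ultrafilter_dist_triangle:
  fixes x :: 'a
  assumes "admissible x \<sigma>" "admissible x \<tau>" "admissible x \<upsilon>"
  shows "ultrafilter_dist \<sigma> \<tau> \<le> ultrafilter_dist \<sigma> \<upsilon> + ultrafilter_dist \<upsilon> \<tau>"
proof -
  have "ennreal (ultrafilter_dist \<sigma> \<tau>)
      \<le> ennreal (ultrafilter_dist \<sigma> \<upsilon>) + ennreal (ultrafilter_dist \<upsilon> \<tau>)"
    using assms wall_outer_measure_triangle[of \<sigma> \<tau> \<upsilon>]
    by (simp add: ennreal_ultrafilter_dist[of x] admissible_iff)
  then show ?thesis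
    by (simp add: ultrafilter_dist_nonneg flip: ennreal_plus)
qed

lemma admissible_point: "admissible x (point_ultrafilter (y::'a))"
  unfolding admissible_iff separating_walls_points
  by (simp add: point_ultrafilter emeasure_wall_measure wall_outer_measure_interval)

lemma ultrafilter_dist_points:
  "ultrafilter_dist (point_ultrafilter x) (point_ultrafilter (y::'a)) = dist x y"
  by (simp add: ultrafilter_dist_def halfspace_measure_sym_diff separating_walls_points
      emeasure_wall_measure wall_outer_measure_interval)

subsection \<open>Admissible ultrafilters on an interval\<close>

text \<open>With \<open>p\<close> as bottom and \<open>q\<close> as top, \<open>med q z a\<close> is
  a join by majority vote, and the outer \<open>med p q\<close> projects it into the interval
  without changing its side of walls between \<open>p\<close> and \<open>q\<close>. The empty join
  is \<open>p\<close>.\<close>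

lemma finite_join:
  fixes p q :: 'a
  assumes "finite F"
  shows "\<exists>z\<in>metric_interval p q. \<forall>h\<in>halfspaces. p \<notin> h \<longrightarrow> q \<in> h \<longrightarrow> (z \<in> h \<longleftrightarrow> (\<exists>x\<in>F. x \<in> h))"
  using assms
proof induction
  case empty
  show ?case
    by (rule bexI[of _ p]) auto
next
  case (insert a F)
  then obtain z where z: "\<And>h. h \<in> halfspaces \<Longrightarrow> p \<notin> h \<Longrightarrow> q \<in> h \<Longrightarrow> z \<in> h \<longleftrightarrow> (\<exists>x\<in>F. x \<in> h)"
    by auto
  show ?case
    by (rule bexI[of _ "med p q (med q z a)"])
      (auto simp: med_mem_halfspace_iff z med_in_intervals)
qed

text \<open>Compactness is applied twice: first a point outside a single \<open>k\<close> is found in all of the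
  halfspaces \<open>h\<close> as a finite join, then such points are combined into a finite meet.\<close>

lemma separate_closed_families:
  fixes p q :: 'a and C D :: "nat \<Rightarrow> 'a set set"
  defines "H \<equiv> {h \<in> halfspaces. p \<notin> h \<and> q \<in> h}"
  assumes C: "\<And>n. finitely_determined (C n)" and D: "\<And>n. finitely_determined (D n)"
    and meet: "\<And>h k. h \<in> H \<Longrightarrow> k \<in> H \<Longrightarrow> (\<And>n. h \<notin> C n) \<Longrightarrow> (\<And>n. k \<notin> D n) \<Longrightarrow> h \<inter> - k \<noteq> {}"
  shows "\<exists>z\<in>metric_interval p q. \<forall>h\<in>H. ((\<forall>n. h \<notin> C n) \<longrightarrow> z \<in> h) \<and> ((\<forall>n. h \<notin> D n) \<longrightarrow> z \<notin> h)"
proof -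
  \<comment> \<open>Compactness in a form serving both applications: if points of \<open>Z\<close>
    give the answer \<open>b\<close> on each halfspace of a closed family, finitely many of them
    suffice. The closed family is the complement of the sets \<open>G n\<close>.\<close>
  have cover: "\<exists>F. finite F \<and> F \<subseteq> Z \<and> (\<forall>h\<in>H. (\<forall>n. h \<notin> G n) \<longrightarrow> (\<exists>z\<in>F. (z \<in> h) = b))"
    if G: "\<And>n. finitely_determined (G n)"
      and Z: "\<And>h. h \<in> H \<Longrightarrow> (\<And>n. h \<notin> G n) \<Longrightarrow> \<exists>z\<in>Z. (z \<in> h) = b"
    for Z and b and G :: "nat \<Rightarrow> 'a set set"
  proof -
    define V where "V = case_sum G (\<lambda>z. {h. (z \<in> h) = b})"
    have "finitely_determined {h. (z \<in> h) = b}" for z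
      by (rule finitely_determined_Collect[of "{z}"]) (simp, blast)
    then have "finitely_determined (V i)" for i
      using G by (cases i) (simp_all add: V_def)
    moreover have "\<exists>i\<in>range Inl \<union> Inr ` Z. h \<in> V i" if h: "h \<in> halfspaces" "p \<notin> h" "q \<in> h" for h
    proof (cases "\<exists>n. h \<in> G n")
      case True
      then obtain n where "h \<in> V (Inl n)"
        by (auto simp: V_def)
      then show ?thesis
        by (intro bexI[of _ "Inl n"]) simp_all
    next
      case False
      then obtain z where "z \<in> Z" "h \<in> V (Inr z)"
        using Z[of h] h by (auto simp: H_def V_def)
      then show ?thesis
        by (intro bexI[of _ "Inr z"]) simp_all
    qed
    ultimately obtain J where J: "finite J" "J \<subseteq> range Inl \<union> Inr ` Z"
      "\<And>h. h \<in> halfspaces \<Longrightarrow> p \<notin> h \<Longrightarrow> q \<in> h \<Longrightarrow> \<exists>i\<in>J. h \<in> V i"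
      by (rule halfspaces_between_compact[of "range Inl \<union> Inr ` Z" V p q]) auto
    define F where "F = Inr -` J"
    have "finite F"
      unfolding F_def by (rule finite_vimageI[OF J(1)]) simp
    moreover have "F \<subseteq> Z"
      using J(2) by (auto simp: F_def)
    moreover have "\<exists>z\<in>F. (z \<in> h) = b" if h: "h \<in> H" "\<forall>n. h \<notin> G n" for h
    proof -
      obtain i where i: "i \<in> J" "h \<in> V i"
        using J(3)[of h] h(1) by (auto simp: H_def)
      then obtain z where "i = Inr z"
        using h(2) by (cases i) (auto simp: V_def)
      then show ?thesis
        using i by (auto simp: F_def V_def)
    qed
    ultimately show ?thesis
      by (intro exI[of _ F]) simp
  qed
  define Z where "Z = {z. \<forall>h\<in>H. (\<forall>n. h \<notin> C n) \<longrightarrow> z \<in> h}"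
  have "\<exists>z\<in>Z. (z \<in> k) = False" if k: "k \<in> H" "\<And>n. k \<notin> D n" for k
  proof -
    have "\<exists>z\<in>- k. (z \<in> h) = True" if "h \<in> H" "\<And>n. h \<notin> C n" for h
      using meet[OF that(1) k(1) that(2) k(2)] by auto
    from cover[of C "- k" True, OF C this]
    obtain F where F: "finite F" "F \<subseteq> - k" "\<And>h. h \<in> H \<Longrightarrow> \<forall>n. h \<notin> C n \<Longrightarrow> \<exists>z\<in>F. z \<in> h"
      by auto
    obtain z where z: "\<And>h. h \<in> H \<Longrightarrow> z \<in> h \<longleftrightarrow> (\<exists>x\<in>F. x \<in> h)"
      using finite_join[OF F(1), of p q] by (auto simp: H_def)
    show ?thesis
    proof (rule bexI[of _ z])
      show "(z \<in> k) = False"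
        using z[OF k(1)] F(2) by auto
      show "z \<in> Z"
        unfolding Z_def using z F(3) by simp
    qed
  qed
  from cover[of D Z False, OF D this]
  obtain F where F: "finite F" "F \<subseteq> Z" "\<And>k. k \<in> H \<Longrightarrow> \<forall>n. k \<notin> D n \<Longrightarrow> \<exists>z\<in>F. z \<notin> k"
    by auto
  \<comment> \<open>Exchanging \<open>p\<close> and \<open>q\<close> and passing to complements
    turns the finite join into a finite meet.\<close>
  obtain z where z: "z \<in> metric_interval q p"
    and z': "\<And>h. h \<in> halfspaces \<Longrightarrow> q \<notin> h \<Longrightarrow> p \<in> h \<Longrightarrow> z \<in> h \<longleftrightarrow> (\<exists>x\<in>F. x \<in> h)"
    using finite_join[OF F(1), of q p] by auto
  have zH: "z \<notin> h \<longleftrightarrow> (\<exists>x\<in>F. x \<notin> h)" if "h \<in> H" for h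
    using z'[of "- h"] that halfspace_Compl[of h] by (simp add: H_def)
  show ?thesis
  proof (intro bexI ballI conjI impI)
    show "z \<in> metric_interval p q"
      using z by (simp add: interval_commute)
    show "z \<in> h" if "h \<in> H" "\<forall>n. h \<notin> C n" for h
      using zH[OF that(1)] that F(2) unfolding Z_def by auto
    show "z \<notin> k" if "k \<in> H" "\<forall>n. k \<notin> D n" for k
      using zH[OF that(1)] that F(3) by simp
  qed
qed

text \<open>With \<open>U\<close> and \<open>V\<close> open sets of nearly the same measure around the walls of
  \<open>wall_interval p q\<close> that do and do not separate \<open>\<sigma>\<close> from \<open>p\<close>, the complements of \<open>V\<close> and \<open>U\<close>
  are compact and are separated by a point; it can differ from \<open>\<sigma>\<close> only on \<open>U \<inter> V\<close>.\<close>

lemma approximate_in_interval: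
  fixes p q :: 'a
  assumes \<sigma>: "halfspace_ultrafilter \<sigma>"
    and meas: "separating_walls \<sigma> (point_ultrafilter p) \<in> sets wall_measure" and "0 < e"
  obtains z where "z \<in> metric_interval p q"
    "wall_outer_measure (wall_interval p q \<inter> separating_walls \<sigma> (point_ultrafilter z)) \<le> ennreal e"
proof -
  let ?\<mu> = wall_outer_measure and ?W = "wall_interval p q"
  let ?sep = "\<lambda>z. separating_walls \<sigma> (point_ultrafilter z)"
  define A B where "A = ?W \<inter> ?sep p" and "B = ?W - ?sep p"
  have AB: "A \<in> sets wall_measure" "B \<in> sets wall_measure"
    unfolding A_def B_def using meas by auto
  have "emeasure wall_measure A + emeasure wall_measure B = emeasure wall_measure (A \<union> B)"
    using AB by (intro plus_emeasure) (auto simp: A_def B_def)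
  moreover have "A \<union> B = ?W"
    by (auto simp: A_def B_def)
  ultimately have sum: "?\<mu> A + ?\<mu> B = ennreal (dist p q)"
    using AB by (simp add: emeasure_wall_measure wall_outer_measure_interval)
  then have "?\<mu> A < \<infinity>" "?\<mu> B < \<infinity>"
    by (metis ennreal_add_eq_top ennreal_neq_top infinity_ennreal_def top.not_eq_extremum)+
  have close: "?\<mu> S < ?\<mu> S + ennreal (e / 2)" if "?\<mu> S < \<infinity>" for S :: "'a set set set"
    using that \<open>0 < e\<close> by (cases "?\<mu> S") (auto simp flip: ennreal_plus simp: ennreal_less_iff)
  obtain a b where ab: "A \<subseteq> (\<Union>n::nat. wall_interval (a n) (b n))"
    "(\<Sum>n. ennreal (dist (a n) (b n))) < ?\<mu> A + ennreal (e / 2)"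
    using wall_outer_measure_close[OF close[OF \<open>?\<mu> A < \<infinity>\<close>]] by metis
  obtain c d where cd: "B \<subseteq> (\<Union>n::nat. wall_interval (c n) (d n))"
    "(\<Sum>n. ennreal (dist (c n) (d n))) < ?\<mu> B + ennreal (e / 2)"
    using wall_outer_measure_close[OF close[OF \<open>?\<mu> B < \<infinity>\<close>]] by metis
  define U V where "U = ?W \<inter> (\<Union>n. wall_interval (a n) (b n))"
    and "V = ?W \<inter> (\<Union>n. wall_interval (c n) (d n))"
  have UV: "U \<in> sets wall_measure" "V \<in> sets wall_measure"
    unfolding U_def V_def by auto
  have "U \<union> V = ?W"
    using ab(1) cd(1) \<open>A \<union> B = ?W\<close> unfolding U_def V_def A_def B_def by auto
  \<comment> \<open>Inclusion-exclusion: \<open>U\<close> and \<open>V\<close> cover the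
    wall-interval, and their measures together exceed its measure by at most \<open>e\<close>; this
    excess bounds the overlap.\<close>
  have "ennreal (dist p q) + ?\<mu> (U \<inter> V) = ?\<mu> U + ?\<mu> V"
    using emeasure_Un_Int[OF UV] UV \<open>U \<union> V = ?W\<close>
    by (simp add: emeasure_wall_measure sets.Int wall_outer_measure_interval)
  also have "\<dots> \<le> (?\<mu> A + ennreal (e / 2)) + (?\<mu> B + ennreal (e / 2))"
    using ab(2) cd(2) unfolding U_def V_def
    by (intro add_mono) (rule order_trans[OF wall_outer_measure_le less_imp_le]; auto)+
  also have "\<dots> = ennreal (dist p q) + ennreal e"
    using \<open>0 < e\<close> unfolding sum[symmetric] by (simp add: ac_simps flip: ennreal_plus)
  finally have small: "?\<mu> (U \<inter> V) \<le> ennreal e"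
    by (simp add: ennreal_add_left_cancel_le)
  have fd: "finitely_determined {h. (x \<in> h) \<noteq> (y \<in> h)}" for x y :: 'a
    by (rule finitely_determined_Collect[of "{x, y}"]) (simp, blast)
  \<comment> \<open>A wall between \<open>p\<close> and \<open>q\<close> outside all intervals
    covering \<open>B\<close> belongs to \<open>A\<close>, so it separates \<sigma> from
    \<open>p\<close>; its side not containing \<open>p\<close> is then in \<sigma>.\<close>
  have in_\<sigma>: "h \<in> \<sigma>"
    if h: "h \<in> halfspaces" "p \<notin> h" "q \<in> h" "\<And>n. h \<notin> {h. (c n \<in> h) \<noteq> (d n \<in> h)}" for h
  proof -
    have "wall_of h \<notin> B"
      using cd(1) h(4) by (auto simp: wall_of_mem_wall_interval[OF h(1)])
    then show ?thesis
      using h(2,3) unfolding B_def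
      by (simp add: wall_of_mem_wall_interval[OF h(1)] mem_point_ultrafilter[OF h(1)]
          wall_of_mem_separating_walls[OF \<sigma> point_ultrafilter h(1)])
  qed
  have notin_\<sigma>: "h \<notin> \<sigma>"
    if h: "h \<in> halfspaces" "p \<notin> h" "q \<in> h" "\<And>n. h \<notin> {h. (a n \<in> h) \<noteq> (b n \<in> h)}" for h
  proof -
    have "wall_of h \<notin> A"
      using ab(1) h(4) by (auto simp: wall_of_mem_wall_interval[OF h(1)])
    then show ?thesis
      using h(2,3) unfolding A_def
      by (simp add: wall_of_mem_wall_interval[OF h(1)] mem_point_ultrafilter[OF h(1)]
          wall_of_mem_separating_walls[OF \<sigma> point_ultrafilter h(1)])
  qed
  have "\<exists>z\<in>metric_interval p q. \<forall>h\<in>{h \<in> halfspaces. p \<notin> h \<and> q \<in> h}.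
      ((\<forall>n. h \<notin> {h. (c n \<in> h) \<noteq> (d n \<in> h)}) \<longrightarrow> z \<in> h) \<and>
      ((\<forall>n. h \<notin> {h. (a n \<in> h) \<noteq> (b n \<in> h)}) \<longrightarrow> z \<notin> h)"
  proof (rule separate_closed_families[OF fd fd])
    fix h k assume "h \<in> {h \<in> halfspaces. p \<notin> h \<and> q \<in> h}" "k \<in> {h \<in> halfspaces. p \<notin> h \<and> q \<in> h}"
      "\<And>n. h \<notin> {h. (c n \<in> h) \<noteq> (d n \<in> h)}" "\<And>n. k \<notin> {h. (a n \<in> h) \<noteq> (b n \<in> h)}"
    then have "h \<in> \<sigma>" "- k \<in> \<sigma>"
      using in_\<sigma>[of h] notin_\<sigma>[of k] ultrafilter_Compl_iff[OF \<sigma>, of k] by simp_all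
    then show "h \<inter> - k \<noteq> {}"
      using \<sigma> unfolding halfspace_ultrafilter_def by meson
  qed
  then obtain z where z: "z \<in> metric_interval p q"
    "\<And>h. h \<in> halfspaces \<Longrightarrow> p \<notin> h \<Longrightarrow> q \<in> h \<Longrightarrow> \<forall>n. (c n \<in> h) = (d n \<in> h) \<Longrightarrow> z \<in> h"
    "\<And>h. h \<in> halfspaces \<Longrightarrow> p \<notin> h \<Longrightarrow> q \<in> h \<Longrightarrow> \<forall>n. (a n \<in> h) = (b n \<in> h) \<Longrightarrow> z \<notin> h"
    by auto
  have key: "wall_of h \<in> U \<inter> V"
    if h: "h \<in> halfspaces" "p \<notin> h" "q \<in> h" "wall_of h \<in> ?sep z" for h
  proof -
    have W: "wall_of h \<in> ?W"
      using h by (simp add: wall_of_mem_wall_interval)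
    have ne: "(h \<in> \<sigma>) \<noteq> (z \<in> h)"
      using h(4) by (simp add: wall_of_mem_separating_walls[OF \<sigma> point_ultrafilter h(1)]
          mem_point_ultrafilter[OF h(1)])
    have "\<exists>n. (c n \<in> h) \<noteq> (d n \<in> h)"
    proof (rule ccontr)
      assume "\<nexists>n. (c n \<in> h) \<noteq> (d n \<in> h)"
      then show False
        using in_\<sigma>[of h] z(2)[of h] h(1-3) ne by simp
    qed
    moreover have "\<exists>n. (a n \<in> h) \<noteq> (b n \<in> h)"
    proof (rule ccontr)
      assume "\<nexists>n. (a n \<in> h) \<noteq> (b n \<in> h)"
      then show False
        using notin_\<sigma>[of h] z(3)[of h] h(1-3) ne by simp
    qed
    ultimately show ?thesis
      using W unfolding U_def V_def by (simp add: wall_of_mem_wall_interval[OF h(1)])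
  qed
  have "?W \<inter> ?sep z \<subseteq> U \<inter> V"
  proof (rule wall_subsetI)
    show "?W \<inter> ?sep z \<subseteq> walls"
      using wall_interval_subset_walls by (rule le_infI1)
    fix h :: "'a set" assume h: "h \<in> halfspaces" and w: "wall_of h \<in> ?W \<inter> ?sep z"
    \<comment> \<open>The previous fact concerns the side containing \<open>q\<close>; for a side
      containing \<open>p\<close> it is applied to the complement, which represents the same
      wall.\<close>
    have eq: "wall_of (- h) = wall_of h"
      by (simp add: wall_of_eq_iff)
    have "(p \<in> h) \<noteq> (q \<in> h)"
      using w by (simp add: wall_of_mem_wall_interval[OF h])
    then show "wall_of h \<in> U \<inter> V"
      using key[of h] key[of "- h"] h w halfspace_Compl[OF h] by (cases "p \<in> h") (simp_all add: eq)
  qed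
  then have "?\<mu> (?W \<inter> ?sep z) \<le> ennreal e"
    using wall_outer_measure_mono small order_trans by metis
  then show thesis
    using that z(1) by simp
qed

subsection \<open>Approximation by points\<close>

text \<open>Induction that treats one more interval each time: \<open>v\<close> approximates
  \<sigma> on the new interval, and \<open>z\<close>, chosen between the old point \<open>y\<close>
  and \<open>v\<close>, combines the two approximations. Only walls from the uncovered part of the
  initial difference may persist with large measure.\<close>

lemma approximate_off_finite_family:
  fixes x :: 'a and p q :: "'i \<Rightarrow> 'a"
  assumes \<sigma>: "admissible x \<sigma>" and "finite J" "0 < e"
  shows "\<exists>y. wall_outer_measure (separating_walls \<sigma> (point_ultrafilter y) -
    (separating_walls \<sigma> (point_ultrafilter x) - (\<Union>j\<in>J. wall_interval (p j) (q j)))) \<le> ennreal e"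
  using assms(2,3)
proof (induction J arbitrary: e)
  case empty
  show ?case
    by (rule exI[of _ x]) simp
next
  case (insert i J)
  let ?\<mu> = wall_outer_measure
  let ?sep = "\<lambda>z. separating_walls \<sigma> (point_ultrafilter z)"
  let ?R = "\<lambda>J. ?sep x - (\<Union>j\<in>J. wall_interval (p j) (q j))"
  have uf: "halfspace_ultrafilter \<sigma>"
    using \<sigma> by (simp add: admissible_iff)
  have e: "0 < e / 3"
    using insert.prems by simp
  have meas: "?sep y \<in> sets wall_measure" for y
    by (rule separating_walls_in_sets[OF \<sigma> admissible_point])
  obtain y where y: "?\<mu> (?sep y - ?R J) \<le> ennreal (e / 3)"
    using insert.IH[OF e] by auto
  obtain v where v: "?\<mu> (wall_interval (p i) (q i) \<inter> ?sep v) \<le> ennreal (e / 3)"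
    using approximate_in_interval[OF uf meas e] by metis
  obtain z where z: "z \<in> metric_interval y v" "?\<mu> (wall_interval y v \<inter> ?sep z) \<le> ennreal (e / 3)"
    using approximate_in_interval[OF uf meas e] by metis
  \<comment> \<open>A wall with \<open>y\<close> and \<open>v\<close> on one side has
    \<open>z\<close> on that side too, so it separates \<sigma> from \<open>z\<close> only if it
    separates \<sigma> from both.\<close>
  have sub: "?sep z - wall_interval y v \<subseteq> ?sep y \<inter> ?sep v"
  proof (rule wall_subsetI)
    show "?sep z - wall_interval y v \<subseteq> walls"
      using separating_walls_subset_walls[OF uf point_ultrafilter] by auto
    fix h :: "'a set" assume h: "h \<in> halfspaces" and w: "wall_of h \<in> ?sep z - wall_interval y v"
    have "(y \<in> h) = (v \<in> h)"
      using w by (simp add: wall_of_mem_wall_interval[OF h])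
    moreover have "y \<in> h \<Longrightarrow> v \<in> h \<Longrightarrow> z \<in> h" "y \<notin> h \<Longrightarrow> v \<notin> h \<Longrightarrow> z \<notin> h"
      using mem_halfspace_of_interval[OF h z(1)]
        mem_halfspace_of_interval[OF halfspace_Compl[OF h] z(1)] by simp_all
    ultimately show "wall_of h \<in> ?sep y \<inter> ?sep v"
      using w by (cases "y \<in> h") (simp_all add: wall_of_mem_separating_walls[OF uf point_ultrafilter h]
          mem_point_ultrafilter[OF h])
  qed
  have "?sep z - ?R (insert i J) \<subseteq> (wall_interval y v \<inter> ?sep z) \<union>
      ((?sep y - ?R J) \<union> (wall_interval (p i) (q i) \<inter> ?sep v))"
    using sub by auto
  then have "?\<mu> (?sep z - ?R (insert i J)) \<le> ?\<mu> ((wall_interval y v \<inter> ?sep z) \<union>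
      ((?sep y - ?R J) \<union> (wall_interval (p i) (q i) \<inter> ?sep v)))"
    by (rule wall_outer_measure_mono)
  also have "\<dots> \<le> ?\<mu> (wall_interval y v \<inter> ?sep z) +
      (?\<mu> (?sep y - ?R J) + ?\<mu> (wall_interval (p i) (q i) \<inter> ?sep v))"
    by (intro order_trans[OF wall_outer_measure_Un] add_mono wall_outer_measure_Un order_refl)
  also have "\<dots> \<le> ennreal (e / 3) + (ennreal (e / 3) + ennreal (e / 3))"
    by (intro add_mono y v z(2))
  also have "\<dots> = ennreal e"
    using e by (simp flip: ennreal_plus)
  finally show ?case
    by (intro exI[of _ z])
qed

text \<open>A cover of the difference from the base point has finite total length, so its tail is
  short. The finitely many initial intervals are handled by the previous induction.\<close>

lemma approximate_by_point:
  fixes x :: 'a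
  assumes \<sigma>: "admissible x \<sigma>" and "0 < e"
  shows "\<exists>y. wall_outer_measure (separating_walls \<sigma> (point_ultrafilter y)) \<le> ennreal e"
proof -
  let ?\<mu> = wall_outer_measure
  let ?sep = "\<lambda>z. separating_walls \<sigma> (point_ultrafilter z)"
  have "?\<mu> (?sep x) < \<infinity>"
    using \<sigma> emeasure_wall_measure unfolding admissible_iff by metis
  then obtain p q where cover: "?sep x \<subseteq> (\<Union>n::nat. wall_interval (p n) (q n))"
    and fin: "(\<Sum>n. ennreal (dist (p n) (q n))) < \<infinity>"
    by (rule wall_outer_measure_close)
  have summable: "summable (\<lambda>n. dist (p n) (q n))"
    using fin by (intro summable_suminf_not_top) auto
  obtain N where N: "norm (\<Sum>n. dist (p (n + N)) (q (n + N))) < e / 2"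
    using suminf_exist_split[OF _ summable, of "e / 2"] \<open>0 < e\<close> by auto
  let ?R = "?sep x - (\<Union>n\<in>{..<N}. wall_interval (p n) (q n))"
  have "?R \<subseteq> (\<Union>n. wall_interval (p (n + N)) (q (n + N)))"
  proof
    fix w assume w: "w \<in> ?R"
    then obtain n where n: "w \<in> wall_interval (p n) (q n)"
      using cover by auto
    then have "N \<le> n"
      using w by (auto simp: not_less[symmetric])
    then have "w \<in> wall_interval (p ((n - N) + N)) (q ((n - N) + N))"
      using n by simp
    then show "w \<in> (\<Union>n. wall_interval (p (n + N)) (q (n + N)))"
      by (rule UN_I[OF UNIV_I])
  qed
  then have "?\<mu> ?R \<le> (\<Sum>n. ennreal (dist (p (n + N)) (q (n + N))))"
    by (rule wall_outer_measure_le)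
  also have "\<dots> = ennreal (\<Sum>n. dist (p (n + N)) (q (n + N)))"
    by (intro suminf_ennreal2 summable_ignore_initial_segment[OF summable]) simp
  also have "\<dots> \<le> ennreal (e / 2)"
    using N by (intro ennreal_leI) simp
  finally have R: "?\<mu> ?R \<le> ennreal (e / 2)" .
  obtain y where y: "?\<mu> (?sep y - ?R) \<le> ennreal (e / 2)"
    using approximate_off_finite_family[OF \<sigma>, of "{..<N}" "e / 2" p q] \<open>0 < e\<close> by auto
  have "?\<mu> (?sep y) \<le> ?\<mu> ((?sep y - ?R) \<union> ?R)"
    by (intro wall_outer_measure_mono) auto
  also have "\<dots> \<le> ?\<mu> (?sep y - ?R) + ?\<mu> ?R"
    by (rule wall_outer_measure_Un)
  also have "\<dots> \<le> ennreal (e / 2) + ennreal (e / 2)"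
    by (intro add_mono y R)
  also have "\<dots> = ennreal e"
    using \<open>0 < e\<close> by (simp flip: ennreal_plus)
  finally show ?thesis
    by (rule exI)
qed

text \<open>Points at distance at most \<open>1 / (n + 1)\<close> from \<sigma> form a Cauchy
  sequence by the triangle inequality, and their limit is at distance zero.\<close>

lemma admissible_eq_point:
  fixes x :: 'a
  assumes \<sigma>: "admissible x \<sigma>" and complete: "complete (UNIV :: 'a set)"
  shows "\<exists>y. ultrafilter_dist \<sigma> (point_ultrafilter y) = 0"
proof -
  let ?d = "\<lambda>y. ultrafilter_dist \<sigma> (point_ultrafilter y)"
  have "\<exists>y. ?d y \<le> inverse (real (Suc n))" for n
    using approximate_by_point[OF \<sigma>, of "inverse (real (Suc n))"]
    by (simp add: ennreal_ultrafilter_dist[OF \<sigma> admissible_point, symmetric])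
  then obtain y where y: "\<And>n. ?d (y n) \<le> inverse (real (Suc n))"
    by metis
  have "Cauchy y"
  proof (rule metric_CauchyI)
    fix e :: real assume "0 < e"
    then obtain N where N: "inverse (real (Suc N)) < e / 2"
      using reals_Archimedean[of "e / 2"] by auto
    have "dist (y m) (y n) < e" if "N \<le> m" "N \<le> n" for m n
    proof -
      have small: "?d (y k) < e / 2" if "N \<le> k" for k
      proof -
        have "inverse (real (Suc k)) \<le> inverse (real (Suc N))"
          using that by (intro le_imp_inverse_le) auto
        then show ?thesis
          using y[of k] N by linarith
      qed
      have "?d (y m) < e / 2" "?d (y n) < e / 2"
        using small that by simp_all
      moreover have "dist (y m) (y n) \<le> ?d (y m) + ?d (y n)"
        using ultrafilter_dist_triangle[OF admissible_point admissible_point \<sigma>, of "y m" "y n"]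
        by (simp add: ultrafilter_dist_points ultrafilter_dist_commute)
      ultimately show ?thesis
        by simp
    qed
    then show "\<exists>M. \<forall>m\<ge>M. \<forall>n\<ge>M. dist (y m) (y n) < e"
      by auto
  qed
  then obtain l where l: "y \<longlonglongrightarrow> l"
    using complete unfolding complete_def by auto
  have le: "?d l \<le> inverse (real (Suc n)) + dist (y n) l" for n
    using ultrafilter_dist_triangle[OF \<sigma> admissible_point admissible_point, of l "y n"] y[of n]
    by (simp add: ultrafilter_dist_points)
  have "(\<lambda>n. inverse (real (Suc n)) + dist (y n) l) \<longlonglongrightarrow> 0 + 0"
    using l by (intro tendsto_add LIMSEQ_inverse_real_of_nat tendsto_dist_iff[THEN iffD1])
  then have "?d l \<le> 0 + 0"
    by (rule LIMSEQ_le_const) (use le in simp)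
  then have "?d l = 0"
    using ultrafilter_dist_nonneg[of \<sigma> "point_ultrafilter l"] by linarith
  then show ?thesis
    by (rule exI)
qed

section \<open>Identification of ultrafilters at distance zero\<close>

lemma dist_zero_rel_Image:
  "dist_zero_rel x `` {\<sigma>} = {\<tau>. admissible x \<sigma> \<and> admissible x \<tau> \<and> ultrafilter_dist \<sigma> \<tau> = 0}"
  by (auto simp: dist_zero_rel_def)

lemma dist_zero_rel_Image_eq:
  fixes x :: 'a
  assumes "admissible x \<sigma>" "admissible x \<tau>" "ultrafilter_dist \<sigma> \<tau> = 0"
  shows "dist_zero_rel x `` {\<sigma>} = dist_zero_rel x `` {\<tau>}"
proof -
  have "ultrafilter_dist \<sigma> \<upsilon> = ultrafilter_dist \<tau> \<upsilon>" if "admissible x \<upsilon>" for \<upsilon>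
    using ultrafilter_dist_triangle[OF assms(1) that assms(2)]
      ultrafilter_dist_triangle[OF assms(2) that assms(1)] assms(3)
    by (simp add: ultrafilter_dist_commute)
  then show ?thesis
    using assms by (auto simp: dist_zero_rel_Image)
qed

text \<open>Changing representatives within a class does not alter the distance, so the union under
  \<open>the_elem\<close> is a singleton, evaluated at the point ultrafilters.\<close>

lemma admissible_space_dist_embedding:
  fixes x\<^sub>0 x y :: 'a
  shows "admissible_space_dist (ultrafilter_embedding x\<^sub>0 x) (ultrafilter_embedding x\<^sub>0 y) = dist x y"
proof -
  let ?x = "point_ultrafilter x" and ?y = "point_ultrafilter y"
  have S: "ultrafilter_embedding x\<^sub>0 z =
      {\<tau>. admissible x\<^sub>0 \<tau> \<and> ultrafilter_dist (point_ultrafilter z) \<tau> = 0}" for z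
    by (simp add: ultrafilter_embedding_def dist_zero_rel_Image admissible_point)
  have "ultrafilter_dist \<sigma> \<tau> = dist x y"
    if "\<sigma> \<in> ultrafilter_embedding x\<^sub>0 x" "\<tau> \<in> ultrafilter_embedding x\<^sub>0 y" for \<sigma> \<tau>
  proof -
    have \<sigma>: "admissible x\<^sub>0 \<sigma>" "ultrafilter_dist ?x \<sigma> = 0"
      and \<tau>: "admissible x\<^sub>0 \<tau>" "ultrafilter_dist ?y \<tau> = 0"
      using that by (simp_all add: S)
    have "ultrafilter_dist \<sigma> \<tau> = ultrafilter_dist ?x \<tau>"
      using ultrafilter_dist_triangle[OF \<sigma>(1) \<tau>(1) admissible_point, of x]
        ultrafilter_dist_triangle[OF admissible_point \<tau>(1) \<sigma>(1), of x] \<sigma>(2)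
      by (simp add: ultrafilter_dist_commute)
    also have "\<dots> = ultrafilter_dist ?x ?y"
      using ultrafilter_dist_triangle[OF admissible_point \<tau>(1) admissible_point, of x y]
        ultrafilter_dist_triangle[OF admissible_point admissible_point \<tau>(1), of x y] \<tau>(2)
      by (simp add: ultrafilter_dist_commute)
    finally show ?thesis
      by (simp add: ultrafilter_dist_points)
  qed
  moreover have "point_ultrafilter z \<in> ultrafilter_embedding x\<^sub>0 z" for z
    by (simp add: S admissible_point ultrafilter_dist_points)
  ultimately have "(\<Union>\<sigma>\<in>ultrafilter_embedding x\<^sub>0 x. \<Union>\<tau>\<in>ultrafilter_embedding x\<^sub>0 y.
      {ultrafilter_dist \<sigma> \<tau>}) = {dist x y}"
    by (intro set_eqI; unfold UN_iff singleton_iff; metis)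
  then show ?thesis
    by (simp add: admissible_space_dist_def)
qed

lemma range_ultrafilter_embedding:
  fixes x\<^sub>0 :: 'a
  assumes "complete (UNIV :: 'a set)"
  shows "range (ultrafilter_embedding x\<^sub>0) = admissible_space x\<^sub>0"
proof
  show "range (ultrafilter_embedding x\<^sub>0) \<subseteq> admissible_space x\<^sub>0"
    by (auto simp: ultrafilter_embedding_def admissible_space_def admissible_point intro!: quotientI)
  show "admissible_space x\<^sub>0 \<subseteq> range (ultrafilter_embedding x\<^sub>0)"
  proof
    fix S assume "S \<in> admissible_space x\<^sub>0"
    then obtain \<sigma> where \<sigma>: "admissible x\<^sub>0 \<sigma>" and S: "S = dist_zero_rel x\<^sub>0 `` {\<sigma>}"
      unfolding admissible_space_def by (auto elim: quotientE)
    obtain y where "ultrafilter_dist \<sigma> (point_ultrafilter y) = 0"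
      using admissible_eq_point[OF \<sigma> assms] by auto
    then have "S = ultrafilter_embedding x\<^sub>0 y"
      unfolding S ultrafilter_embedding_def by (rule dist_zero_rel_Image_eq[OF \<sigma> admissible_point])
    then show "S \<in> range (ultrafilter_embedding x\<^sub>0)"
      by simp
  qed
qed

end

theorem theorem1:
  fixes x\<^sub>0 :: "'a::metric_space"
  assumes "median_space TYPE('a)"
    and "locally_median_convex TYPE('a)"
    and "complete (UNIV :: 'a set)"
  shows "(\<forall>x y. admissible_space_dist (ultrafilter_embedding x\<^sub>0 x) (ultrafilter_embedding x\<^sub>0 y)
                  = dist x y)
       \<and> range (ultrafilter_embedding x\<^sub>0) = admissible_space x\<^sub>0"
proof -
  interpret median_metric "TYPE('a)"
    by unfold_locales (rule assms(1))
  show ?thesis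
    using admissible_space_dist_embedding range_ultrafilter_embedding[OF assms(3)] by simp
qed

end
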